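(* Let $f=f^*\in L^1(I)$ and let $\mathcal{B}=(b_n)$ be an interval partition. If $\mathcal{B}$ averages the principal symmetric ideal $\mathcal{N}_f$, then there is a constant $Q>1$ such that $$f^{**}(b_n)\le Q\, f(Q^{-1}b_n),\qquad n\ge1.$$ Moreover, if the partition $\mathcal{B}$ is monotonic, then this condition is not only necessary but also sufficient for $\mathcal{B}$ to average $\mathcal{N}_f$.
   Context: $I=(0,1]$ with the Lebesgue $\sigma$-algebra $\Lambda$ and Lebesgue measure $\lambda$. For $f\in L^1(I)$, $f^*$ is the non-increasing right-continuous function on $I$ equimeasurable with $|f|$; $f=f^*$ means $f$ is itself such a (non-negative non-increasing) function; $f^{**}(t)=\frac1t\int_0^tf^*d\lambda$. An interval partition $\mathcal{B}=(b_n)$ is the $\sigma$-subalgebra (with null sets) generated by the atoms $(b_n,b_{n-1}]$, $n\ge1$, where $1=b_0>b_1>\dots$, $b_n\to0$; it is monotonic if the lengths $\beta_n=b_{n-1}-b_n$ are non-increasing in $n$. A symmetric ideal is a vector space $X$, $L^\infty(I)\subseteq X\subseteq L^1(I)$, such that $x\in X$, $|y|\le|x|$ imply $y\in X$, and $x\in X$, $y\in L^1(I)$, $y^*\le x^*$ imply $y\in X$. $\mathcal{N}_f$ is the smallest symmetric ideal containing $f$; explicitly (for $f\ne0$) $\mathcal{N}_f=\{z\in L^1(I): \exists q>1\ \ z^*(t)\le q f^*(q^{-1}t),\ t\in I\}$. A $\sigma$-subalgebra $\mathcal{A}$ averages $X$ if $E(X|\mathcal{A})\subseteq X$, where $E(\cdot|\mathcal{A})$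 is conditional expectation. *)

theory Defs
  imports "HOL-Probability.Probability"
begin

abbreviation I :: "real set" where "I \<equiv> {0<..1}"

abbreviation lam :: "real measure" where "lam \<equiv> lebesgue_on I"

text \<open>The spaces over \<open>I\<close> consist of functions rather than of classes modulo null sets; only the
  values on \<open>I\<close> matter.  All sets of functions below that are relevant (in particular symmetric
  ideals) are closed under changing a function on a null set.\<close>

definition L1 :: "(real \<Rightarrow> real) set" where
  "L1 = {f. integrable lam f}"

definition Linf :: "(real \<Rightarrow> real) set" where
  "Linf = {f \<in> borel_measurable lam. \<exists>C. AE t in lam. \<bar>f t\<bar> \<le> C}"

subsection \<open>Non-increasing rearrangement\<close>

text \<open>Right-continuity on \<open>I\<close> imposes nothing at the right endpoint \<open>1\<close>, so a rearrangement is
  unique only on the open interval \<open>{0<..<1}\<close>.\<close>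

definition is_rearrangement :: "(real \<Rightarrow> real) \<Rightarrow> (real \<Rightarrow> real) \<Rightarrow> bool" where
  "is_rearrangement g f \<longleftrightarrow>
     (\<forall>t\<in>I. 0 \<le> g t) \<and> antimono_on I g \<and> (\<forall>t\<in>{0<..<1}. continuous (at_right t) g) \<and>
     (\<forall>s. measure lam {t \<in> I. g t > s} = measure lam {t \<in> I. \<bar>f t\<bar> > s})"

text \<open>The standard formula for \<open>f\<^sup>*\<close>; it picks the value \<open>0\<close> at \<open>1\<close>.  The lemmas below
  show that it is a rearrangement, and the only one on \<open>{0<..<1}\<close>.\<close>

definition rearr :: "(real \<Rightarrow> real) \<Rightarrow> real \<Rightarrow> real" where
  "rearr f t = Inf {s. 0 \<le> s \<and> measure lam {u \<in> I. \<bar>f u\<bar> > s} \<le> t}"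

definition max_rearr :: "(real \<Rightarrow> real) \<Rightarrow> real \<Rightarrow> real" where
  "max_rearr f t = (1 / t) * (LINT s:{0<..t}|lebesgue. rearr f s)"

lemma finite_measure_lam: "finite_measure lam"
  by (rule finite_measure_lebesgue_on) (simp add: fmeasurable_def)

lemma sets_level: "f \<in> borel_measurable lam \<Longrightarrow> {u \<in> I. \<bar>f u\<bar> > s} \<in> sets lam"
  for f :: "real \<Rightarrow> real"
proof -
  assume "f \<in> borel_measurable lam"
  then have "{u \<in> space lam. \<bar>f u\<bar> > s} \<in> sets lam" by measurable
  then show ?thesis by (simp only: space_lebesgue_on)
qed

lemma level_antimono:
  fixes f :: "real \<Rightarrow> real"
  assumes "f \<in> borel_measurable lam" "s \<le> s'"
  shows "measure lam {u \<in> I. \<bar>f u\<bar> > s'} \<le> measure lam {u \<in> I. \<bar>f u\<bar> > s}"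
  by (rule finite_measure.finite_measure_mono[OF finite_measure_lam _ sets_level]) (use assms in auto)

lemma level_right:
  fixes f :: "real \<Rightarrow> real"
  assumes f: "f \<in> borel_measurable lam" and t: "measure lam {u \<in> I. \<bar>f u\<bar> > s} > t"
  shows "\<exists>s'>s. measure lam {u \<in> I. \<bar>f u\<bar> > s'} > t"
proof -
  define A where "A n = {u \<in> I. \<bar>f u\<bar> > s + 1 / real (Suc n)}" for n
  have inc: "incseq A"
  proof (rule incseq_SucI, rule subsetI)
    fix n u assume u: "u \<in> A n"
    have "1 / real (Suc (Suc n)) \<le> 1 / real (Suc n)" by (rule frac_le) auto
    with u show "u \<in> A (Suc n)" unfolding A_def by auto
  qed
  have U: "(\<Union>n. A n) = {u \<in> I. \<bar>f u\<bar> > s}"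
  proof (intro equalityI subsetI)
    fix u assume u: "u \<in> {u \<in> I. \<bar>f u\<bar> > s}"
    then obtain n where "inverse (real (Suc n)) < \<bar>f u\<bar> - s"
      using reals_Archimedean[of "\<bar>f u\<bar> - s"] by auto
    with u have "u \<in> A n" by (auto simp: A_def inverse_eq_divide)
    then show "u \<in> (\<Union>n. A n)" by blast
  next
    fix u assume "u \<in> (\<Union>n. A n)"
    then obtain n where n: "u \<in> I" "\<bar>f u\<bar> > s + 1 / real (Suc n)" by (auto simp: A_def)
    moreover have "1 / real (Suc n) > 0" by simp
    ultimately have "\<bar>f u\<bar> > s" by linarith
    with n show "u \<in> {u \<in> I. \<bar>f u\<bar> > s}" by simp
  qed
  have "(\<lambda>n. measure lam (A n)) \<longlonglongrightarrow> measure lam (\<Union>n. A n)"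
    using finite_measure.finite_Lim_measure_incseq[OF finite_measure_lam _ inc]
      sets_level[OF f] by (auto simp: A_def)
  then have "eventually (\<lambda>n. measure lam (A n) > t) sequentially"
    using t unfolding U by (rule order_tendstoD)
  then obtain n where "measure lam (A n) > t"
    by (auto simp: eventually_sequentially)
  moreover have "s + 1 / real (Suc n) > s" by simp
  ultimately show ?thesis unfolding A_def by blast
qed

lemma level_small:
  fixes f :: "real \<Rightarrow> real"
  assumes f: "f \<in> borel_measurable lam" and t: "t > 0"
  shows "\<exists>s\<ge>0. measure lam {u \<in> I. \<bar>f u\<bar> > s} \<le> t"
proof -
  define A where "A n = {u \<in> I. \<bar>f u\<bar> > real n}" for n
  have dec: "decseq A" unfolding A_def decseq_def by auto
  have "(\<Inter>n. A n) = {}"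
  proof -
    have "\<exists>n. u \<notin> A n" for u
    proof -
      obtain n where "\<bar>f u\<bar> < real n" using reals_Archimedean2 by blast
      then have "u \<notin> A n" by (simp add: A_def)
      then show ?thesis ..
    qed
    then show ?thesis by blast
  qed
  moreover have "(\<lambda>n. measure lam (A n)) \<longlonglongrightarrow> measure lam (\<Inter>n. A n)"
    using finite_measure.finite_Lim_measure_decseq[OF finite_measure_lam _ dec]
      sets_level[OF f] by (auto simp: A_def)
  ultimately have "eventually (\<lambda>n. measure lam (A n) < t) sequentially"
    using t by (auto dest: order_tendstoD(2))
  then obtain n where "measure lam (A n) < t" by (auto simp: eventually_sequentially)
  then show ?thesis unfolding A_def by (intro exI[of _ "real n"]) auto
qed

lemma rearr_nonneg: "f \<in> borel_measurable lam \<Longrightarrow> t > 0 \<Longrightarrow> rearr f t \<ge> 0"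
  unfolding rearr_def using level_small[of f t] by (intro cInf_greatest) auto

lemma rearr_greater_iff:
  assumes f: "f \<in> borel_measurable lam" and "t > 0" "s \<ge> 0"
  shows "rearr f t > s \<longleftrightarrow> measure lam {u \<in> I. \<bar>f u\<bar> > s} > t"
proof
  assume *: "rearr f t > s"
  show "measure lam {u \<in> I. \<bar>f u\<bar> > s} > t"
  proof (rule ccontr)
    assume "\<not> ?thesis"
    then have "rearr f t \<le> s" unfolding rearr_def
      using \<open>s \<ge> 0\<close> by (intro cInf_lower) (auto intro!: bdd_belowI[of _ 0])
    with * show False by simp
  qed
next
  assume "measure lam {u \<in> I. \<bar>f u\<bar> > s} > t"
  from level_right[OF f this] obtain s' where
    s': "s' > s" "measure lam {u \<in> I. \<bar>f u\<bar> > s'} > t" by blast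
  have "s' \<le> rearr f t" unfolding rearr_def
  proof (rule cInf_greatest)
    show "{s. 0 \<le> s \<and> measure lam {u \<in> I. \<bar>f u\<bar> > s} \<le> t} \<noteq> {}"
      using level_small[OF f \<open>t > 0\<close>] by auto
    fix r assume "r \<in> {s. 0 \<le> s \<and> measure lam {u \<in> I. \<bar>f u\<bar> > s} \<le> t}"
    then show "s' \<le> r" using s' level_antimono[OF f, of r s'] by (cases "s' \<le> r") auto
  qed
  with s' show "rearr f t > s" by simp
qed

lemma measure_lam_greaterThanLessThan: "0 \<le> a \<Longrightarrow> a \<le> 1 \<Longrightarrow> measure lam {0<..<a} = a"
  by (subst measure_restrict_space) auto

lemma measure_lam_greaterThanAtMost: "0 \<le> a \<Longrightarrow> a \<le> 1 \<Longrightarrow> measure lam {0<..a} = a"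
  by (subst measure_restrict_space) auto

lemma level_le_1: "measure lam {u \<in> I. \<bar>f u\<bar> > s} \<le> 1" for s :: real
  using finite_measure.bounded_measure[OF finite_measure_lam, of "{u \<in> I. \<bar>f u\<bar> > s}"]
    measure_lam_greaterThanAtMost[of 1] by (simp add: space_lebesgue_on)

lemma is_rearrangement_rearr:
  assumes f: "f \<in> borel_measurable lam"
  shows "is_rearrangement (rearr f) f"
  unfolding is_rearrangement_def
proof (intro conjI ballI allI)
  show "0 \<le> rearr f t" if "t \<in> I" for t using rearr_nonneg[OF f] that by simp
  have mono: "rearr f u \<le> rearr f t" if "0 < t" "t \<le> u" for t u
  proof (rule ccontr)
    assume "\<not> ?thesis"
    then show False
      using rearr_greater_iff[OF f, of u "rearr f t"] rearr_greater_iff[OF f, of t "rearr f t"]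
        rearr_nonneg[OF f, of t] that by simp
  qed
  then show "antimono_on I (rearr f)" by (auto intro!: monotone_onI)
  show "continuous (at_right t) (rearr f)" if t: "t \<in> {0<..<1}" for t
    unfolding continuous_within
  proof (rule order_tendstoI)
    fix a assume a: "a < rearr f t"
    show "eventually (\<lambda>u. a < rearr f u) (at_right t)"
    proof (cases "a < 0")
      case True
      have "a < rearr f u" if "t < u" for u
        using rearr_nonneg[OF f, of u] that t True by simp
      then show ?thesis by (auto simp: eventually_at_right_field intro: exI[of _ "t + 1"])
    next
      case False
      let ?d = "measure lam {u \<in> I. \<bar>f u\<bar> > a}"
      have "t < ?d" using rearr_greater_iff[OF f, of t a] a False t by simp
      moreover have "a < rearr f u" if "t < u" "u < ?d" for u
        using rearr_greater_iff[OF f, of u a] that False t by simp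
      ultimately show ?thesis by (auto simp: eventually_at_right_field)
    qed
  next
    fix a assume "rearr f t < a"
    then have "rearr f u < a" if "t < u" for u
      using mono[of t u] that t by simp
    then show "eventually (\<lambda>u. rearr f u < a) (at_right t)"
      by (auto simp: eventually_at_right_field intro: exI[of _ "t + 1"])
  qed
  fix s :: real
  let ?d = "measure lam {u \<in> I. \<bar>f u\<bar> > s}"
  show "measure lam {t \<in> I. rearr f t > s} = ?d"
  proof (cases "s < 0")
    case True
    have "{t \<in> I. rearr f t > s} = I"
      using rearr_nonneg[OF f] True by force
    moreover have "{t \<in> I. \<bar>f t\<bar> > s} = I" using True by auto
    ultimately show ?thesis by simp
  next
    case False
    have "{t \<in> I. rearr f t > s} = {0<..<?d} \<inter> I"
      using rearr_greater_iff[OF f, of _ s] False by auto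
    also have "\<dots> = {0<..<?d}" using level_le_1[where f=f and s=s] by auto
    finally show ?thesis
      using measure_lam_greaterThanLessThan[of ?d] level_le_1[where f=f and s=s] by simp
  qed
qed

lemma is_rearrangement_le:
  assumes g: "is_rearrangement g f" and h: "is_rearrangement h f" and t: "t \<in> {0<..<1}"
  shows "h t \<le> g t"
proof (rule ccontr)
  assume "\<not> ?thesis"
  then obtain s where s: "g t < s" "s < h t" using dense[of "g t" "h t"] by auto
  have "(h \<longlongrightarrow> h t) (at_right t)"
    using h t by (auto simp: is_rearrangement_def continuous_within)
  then have "eventually (\<lambda>u. s < h u) (at_right t)" using s by (auto dest: order_tendstoD(1))
  then obtain b where b: "b > t" "\<And>u. t < u \<Longrightarrow> u < b \<Longrightarrow> s < h u"
    by (auto simp: eventually_at_right_field)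
  define c where "c = min ((t + b) / 2) 1"
  have c: "t < c" "c \<le> 1" "c < b" using b t by (auto simp: c_def min_def field_simps)
  have hc: "s < h c" using b c by simp
  have ha: "antimono_on I h" and ga: "antimono_on I g"
    using g h by (auto simp: is_rearrangement_def)
  have eq: "measure lam {t \<in> I. g t > s} = measure lam {t \<in> I. h t > s}"
    using g h by (simp add: is_rearrangement_def)
  have hm: "{0<..c} \<subseteq> {u \<in> I. h u > s}"
    using monotone_onD[OF ha, of _ c] hc c t by fastforce
  have gm: "{u \<in> I. g u > s} \<subseteq> {0<..t}"
  proof
    fix u assume u: "u \<in> {u \<in> I. g u > s}"
    show "u \<in> {0<..t}"
      using monotone_onD[OF ga, of t u] u t s by (cases "u \<le> t") auto
  qed
  have mh: "{u \<in> I. h u > s} \<in> sets lam"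
  proof -
    have "is_interval {u \<in> I. h u > s}"
    proof (unfold is_interval_1, intro ballI allI impI, elim conjE)
      fix x y z assume *: "x \<in> {u \<in> I. h u > s}" "y \<in> {u \<in> I. h u > s}" "x \<le> z" "z \<le> y"
      then show "z \<in> {u \<in> I. h u > s}" using monotone_onD[OF ha, of z y] by fastforce
    qed
    then have "{u \<in> I. h u > s} \<in> sets borel"
      by (rule real_interval_borel_measurable)
    then have "{u \<in> I. h u > s} \<in> sets lebesgue" by simp
    then show ?thesis by (subst sets_restrict_space_iff) auto
  qed
  have "c = measure lam {0<..c}" using measure_lam_greaterThanAtMost[of c] c t by simp
  also have "\<dots> \<le> measure lam {u \<in> I. h u > s}"
    by (intro finite_measure.finite_measure_mono[OF finite_measure_lam] hm mh)
  also have "\<dots> = measure lam {u \<in> I. g u > s}" using eq by simp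
  also have "\<dots> \<le> measure lam {0<..t}"
    by (intro finite_measure.finite_measure_mono[OF finite_measure_lam] gm)
       (subst sets_restrict_space_iff, use t in auto)
  also have "\<dots> = t" using measure_lam_greaterThanAtMost[of t] t by simp
  finally show False using c by simp
qed

lemma is_rearrangement_unique:
  assumes "is_rearrangement g f" "is_rearrangement h f" "t \<in> {0<..<1}"
  shows "g t = h t"
  using is_rearrangement_le assms by (metis order_antisym)

subsection \<open>Symmetric ideals\<close>

text \<open>Closure under pointwise addition and scalar multiplication, together with \<open>Linf \<subseteq> X\<close>, says
  that \<open>X\<close> is a vector space (the function space is not an instance of the vector space class).\<close>

definition symmetric_ideal :: "(real \<Rightarrow> real) set \<Rightarrow> bool" where
  "symmetric_ideal X \<longleftrightarrow>
     Linf \<subseteq> X \<and> X \<subseteq> L1 \<and>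
     (\<forall>x\<in>X. \<forall>y\<in>X. (\<lambda>t. x t + y t) \<in> X) \<and>
     (\<forall>c. \<forall>x\<in>X. (\<lambda>t. c * x t) \<in> X) \<and>
     (\<forall>x\<in>X. \<forall>y\<in>borel_measurable lam. (AE t in lam. \<bar>y t\<bar> \<le> \<bar>x t\<bar>) \<longrightarrow> y \<in> X) \<and>
     (\<forall>x\<in>X. \<forall>y\<in>L1. (\<forall>t\<in>I. rearr y t \<le> rearr x t) \<longrightarrow> y \<in> X)"

definition principal_ideal :: "(real \<Rightarrow> real) \<Rightarrow> (real \<Rightarrow> real) set" where
  "principal_ideal f = \<Inter> {X. symmetric_ideal X \<and> f \<in> X}"

lemma symmetric_ideal_L1: "symmetric_ideal L1"
proof -
  have "Linf \<subseteq> L1"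
  proof
    fix x assume "x \<in> Linf"
    then obtain C where "x \<in> borel_measurable lam" "AE t in lam. norm (x t) \<le> C"
      by (auto simp: Linf_def)
    then show "x \<in> L1"
      unfolding L1_def using finite_measure.integrable_const_bound[OF finite_measure_lam] by blast
  qed
  moreover have "y \<in> L1" if "x \<in> L1" "y \<in> borel_measurable lam" "AE t in lam. \<bar>y t\<bar> \<le> \<bar>x t\<bar>" for x y
  proof -
    have "AE t in lam. norm (y t) \<le> norm (x t)" using that(3) by simp
    with that(1,2) show ?thesis
      unfolding L1_def mem_Collect_eq by (rule Bochner_Integration.integrable_bound)
  qed
  moreover have "(\<lambda>t. x t + y t) \<in> L1" if "x \<in> L1" "y \<in> L1" for x y
    using that unfolding L1_def mem_Collect_eq by (rule Bochner_Integration.integrable_add)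
  moreover have "(\<lambda>t. c * x t) \<in> L1" if "x \<in> L1" for c x
    using that unfolding L1_def mem_Collect_eq by (rule integrable_mult_right)
  ultimately show ?thesis unfolding symmetric_ideal_def
    by (intro conjI ballI allI impI) (assumption | rule subset_refl)+
qed

lemma symmetric_idealD:
  assumes "symmetric_ideal X"
  shows "Linf \<subseteq> X" and "X \<subseteq> L1"
    and "x \<in> X \<Longrightarrow> y \<in> X \<Longrightarrow> (\<lambda>t. x t + y t) \<in> X"
    and "x \<in> X \<Longrightarrow> (\<lambda>t. c * x t) \<in> X"
    and "x \<in> X \<Longrightarrow> y \<in> borel_measurable lam \<Longrightarrow> AE t in lam. \<bar>y t\<bar> \<le> \<bar>x t\<bar> \<Longrightarrow> y \<in> X"
    and "x \<in> X \<Longrightarrow> y \<in> L1 \<Longrightarrow> \<forall>t\<in>I. rearr y t \<le> rearr x t \<Longrightarrow> y \<in> X"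
proof -
  note * = assms[unfolded symmetric_ideal_def]
  show "Linf \<subseteq> X" "X \<subseteq> L1" using * by simp_all
  show "(\<lambda>t. x t + y t) \<in> X" if "x \<in> X" "y \<in> X"
    by (rule bspec[OF bspec[OF conjunct1[OF conjunct2[OF conjunct2[OF *]]] that(1)] that(2)])
  show "(\<lambda>t. c * x t) \<in> X" if "x \<in> X"
    by (rule bspec[OF spec[OF conjunct1[OF conjunct2[OF conjunct2[OF conjunct2[OF *]]]]] that])
  show "y \<in> X" if "x \<in> X" "y \<in> borel_measurable lam" "AE t in lam. \<bar>y t\<bar> \<le> \<bar>x t\<bar>"
    by (rule mp[OF bspec[OF bspec[OF conjunct1[OF conjunct2[OF conjunct2[OF conjunct2[OF conjunct2[OF *]]]]]
          that(1)] that(2)] that(3)])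
  show "y \<in> X" if "x \<in> X" "y \<in> L1" "\<forall>t\<in>I. rearr y t \<le> rearr x t"
    by (rule mp[OF bspec[OF bspec[OF conjunct2[OF conjunct2[OF conjunct2[OF conjunct2[OF conjunct2[OF *]]]]]
          that(1)] that(2)] that(3)])
qed

lemma principal_ideal_least:
  assumes "f \<in> L1"
  shows "symmetric_ideal (principal_ideal f)" "f \<in> principal_ideal f"
    "\<And>X. symmetric_ideal X \<Longrightarrow> f \<in> X \<Longrightarrow> principal_ideal f \<subseteq> X"
proof -
  show "f \<in> principal_ideal f" by (simp add: principal_ideal_def)
  show least: "principal_ideal f \<subseteq> X" if "symmetric_ideal X" "f \<in> X" for X
    using that by (auto simp: principal_ideal_def)
  have I: "x \<in> principal_ideal f" if "\<And>X. symmetric_ideal X \<Longrightarrow> f \<in> X \<Longrightarrow> x \<in> X" for x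
    using that by (simp add: principal_ideal_def)
  have D: "x \<in> X" if "x \<in> principal_ideal f" "symmetric_ideal X" "f \<in> X" for x X
    by (rule subsetD[OF least[OF that(2,3)] that(1)])
  show "symmetric_ideal (principal_ideal f)"
    unfolding symmetric_ideal_def
  proof (intro conjI ballI allI impI)
    show "Linf \<subseteq> principal_ideal f" by (rule subsetI, rule I, rule subsetD[OF symmetric_idealD(1)])
    show "principal_ideal f \<subseteq> L1" by (rule least[OF symmetric_ideal_L1 assms])
  next
    fix x y assume *: "x \<in> principal_ideal f" "y \<in> principal_ideal f"
    show "(\<lambda>t. x t + y t) \<in> principal_ideal f"
      by (rule I, rule symmetric_idealD(3)[OF _ D[OF *(1)] D[OF *(2)]])
  next
    fix c x assume *: "x \<in> principal_ideal f"
    show "(\<lambda>t. c * x t) \<in> principal_ideal f"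
      by (rule I, rule symmetric_idealD(4)[OF _ D[OF *]])
  next
    fix x y assume *: "x \<in> principal_ideal f" "y \<in> borel_measurable lam" "AE t in lam. \<bar>y t\<bar> \<le> \<bar>x t\<bar>"
    show "y \<in> principal_ideal f"
      by (rule I, rule symmetric_idealD(5)[OF _ D[OF *(1)] *(2,3)])
  next
    fix x y assume *: "x \<in> principal_ideal f" "y \<in> L1" "\<forall>t\<in>I. rearr y t \<le> rearr x t"
    show "y \<in> principal_ideal f"
      by (rule I, rule symmetric_idealD(6)[OF _ D[OF *(1)] *(2,3)])
  qed
qed

subsection \<open>Interval partitions and averaging\<close>

definition interval_partition :: "(nat \<Rightarrow> real) \<Rightarrow> bool" where
  "interval_partition b \<longleftrightarrow> b 0 = 1 \<and> (\<forall>n. b (Suc n) < b n) \<and> b \<longlonglongrightarrow> 0"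

definition monotonic_partition :: "(nat \<Rightarrow> real) \<Rightarrow> bool" where
  "monotonic_partition b \<longleftrightarrow> decseq (\<lambda>n. b n - b (Suc n))"

definition partition_algebra :: "(nat \<Rightarrow> real) \<Rightarrow> real measure" where
  "partition_algebra b = sigma I (range (\<lambda>n. {b (Suc n)<..b n}) \<union> null_sets lam)"

lemma subalgebra_partition_algebra:
  assumes "interval_partition b"
  shows "subalgebra lam (partition_algebra b)"
proof -
  have dec: "decseq b" using assms
    by (intro decseq_SucI) (simp add: interval_partition_def order.strict_implies_order)
  have ge: "0 \<le> b n" for n
    using decseq_ge[OF dec] assms by (simp add: interval_partition_def)
  have le: "b n \<le> 1" for n
    using decseqD[OF dec, of 0 n] assms by (simp add: interval_partition_def)
  have sub: "{b (Suc n)<..b n} \<subseteq> I" for n using ge[of "Suc n"] le[of n] by auto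
  have "range (\<lambda>n. {b (Suc n)<..b n}) \<subseteq> sets lam"
    using sub by (auto simp: sets_restrict_space_iff)
  then have gen: "range (\<lambda>n. {b (Suc n)<..b n}) \<union> null_sets lam \<subseteq> sets lam" by auto
  have Pow: "sets lam \<subseteq> Pow I" using sets.space_closed[of lam] by (simp only: space_lebesgue_on)
  have "sigma_sets I (range (\<lambda>n. {b (Suc n)<..b n}) \<union> null_sets lam) \<subseteq> sets lam"
    using sets.sigma_sets_subset[OF gen] by (simp only: space_lebesgue_on)
  then show ?thesis
    unfolding subalgebra_def partition_algebra_def
    using order_trans[OF gen Pow]
    by (simp only: space_measure_of sets_measure_of space_lebesgue_on simp_thms)
qed

text \<open>Conditional expectations are only determined almost everywhere, but membership in a symmetric
  ideal does not depend on the version.\<close>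

definition averages :: "real measure \<Rightarrow> (real \<Rightarrow> real) set \<Rightarrow> bool" where
  "averages A X \<longleftrightarrow> (\<forall>x\<in>X. real_cond_exp lam A x \<in> X)"

end

theory Submission imports Defs begin

text \<open>Write $J(c) = \int_0^c f$, so that $f^{**}(c) = J(c)/c$.  Everything rests on three facts.

  First, the principal ideal of \<open>f\<close> consists of the \<open>z \<in> L1\<close> with
  $z^*(t) \le q f(t/q) + q$ for some \<open>q > 1\<close> (\<open>principal_ideal_decreasing\<close>).  The additive \<open>q\<close> accounts
  for the bounded functions, which belong to every symmetric ideal; with it the description also
  covers \<open>f = 0\<close>.

  Secondly, the atoms of the partition are atoms of the measure algebra: a set of the partition
  algebra meets each of them in a null or a conull set (\<open>partition_algebra_dichotomy\<close>).
  Everything about $E(\cdot|\mathcal{B})$ below follows from this and from the identity of integrals that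
  defines it.

  Thirdly, inequalities between integrals are inequalities between the measures of level sets
  (\<open>integral_le_of_levels\<close>), and the level sets of a decreasing function are initial intervals.

  Sufficiency.  Let \<open>x\<close> be in the ideal and $b_{n+1} \le t < b_n$.  If $E(x|\mathcal{B})^*(t) > s$, then
  $A = \{|E(x|\mathcal{B})| > s\}$ has measure greater than $t \ge b_{n+1}$, so it cannot be contained in
  $(0, b_{n+1}]$ and must contain one of the first \<open>n + 1\<close> atoms.  By monotonicity that atom has length at
  least $b_n - b_{n+1}$; hence $|A| \ge b_n/2$.  Now $s|A| \le \int_A |x|$, and the bound on $x^*$ turns this
  into an estimate of \<open>s\<close> by a multiple of $f^{**}(b_n) + 1$, which the hypothesis bounds by a multiple of
  $f(t/Q) + 1$.

  Necessity.  If no \<open>Q\<close> works, there are indices $0 = r_0 < r_1 < \dots$, as sparse as one likes, with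
  $f^{**}(b_{r_j}) > (j+1) f(b_{r_j}/(j+1))$ for $j \ge 1$.  The blocks $(b_{r_{j+1}}, b_{r_j}]$ are unions of atoms.
  Let \<open>T\<close> map every atom affinely onto the block that contains it.  Then \<open>T\<close> preserves measure on each
  block, so \<open>f \<circ> T\<close> is in the ideal; but its average over each atom is the average of \<open>f\<close> over the whole
  block, which by sparsity is at least $f^{**}(b_{r_j})/2$.  So $E(f \circ T|\mathcal{B})$ is this large on a set of
  measure at least $b_{r_j}/2$, and its membership in the ideal gives
  $f^{**}(b_{r_j}) \le Q f(b_{r_j}/Q)$ with a \<open>Q\<close> independent of \<open>j\<close>, a contradiction for large \<open>j\<close>.
  Here \<open>T\<close> is \<open>spread\<close>.\<close>

section \<open>Rearrangements and distribution functions\<close>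

lemma rearr_le_iff:
  assumes "f \<in> borel_measurable lam" "t > 0" "s \<ge> 0"
  shows "rearr f t \<le> s \<longleftrightarrow> measure lam {u \<in> I. \<bar>f u\<bar> > s} \<le> t"
  using rearr_greater_iff[OF assms] by linarith

lemma rearr_mono:
  assumes x: "x \<in> borel_measurable lam" and y: "y \<in> borel_measurable lam" and t: "t > 0"
    and le: "\<And>s. s \<ge> 0 \<Longrightarrow> measure lam {u \<in> I. \<bar>y u\<bar> > s} \<le> measure lam {u \<in> I. \<bar>x u\<bar> > s}"
  shows "rearr y t \<le> rearr x t"
proof -
  have 0: "rearr x t \<ge> 0" using rearr_nonneg[OF x t] .
  have "measure lam {u \<in> I. \<bar>x u\<bar> > rearr x t} \<le> t"
    using rearr_le_iff[OF x t 0] by simp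
  then show ?thesis using rearr_le_iff[OF y t 0] le[OF 0] by linarith
qed

text \<open>If \<open>\<bar>x + y\<bar>\<close> exceeds a sum of two thresholds, then \<open>\<bar>x\<bar>\<close> or \<open>\<bar>y\<bar>\<close> exceeds its own threshold; each of
  these two events gets half of the measure \<open>t\<close>.\<close>

lemma rearr_add:
  assumes x: "x \<in> borel_measurable lam" and y: "y \<in> borel_measurable lam" and t: "t > 0"
  shows "rearr (\<lambda>u. x u + y u) t \<le> rearr x (t / 2) + rearr y (t / 2)"
proof -
  let ?a = "rearr x (t / 2)" and ?b = "rearr y (t / 2)"
  have t2: "t / 2 > 0" using t by simp
  have a: "?a \<ge> 0" and b: "?b \<ge> 0" using rearr_nonneg x y t2 by auto
  have xy: "(\<lambda>u. x u + y u) \<in> borel_measurable lam" using x y by simp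
  have "measure lam {u \<in> I. \<bar>x u + y u\<bar> > ?a + ?b}
      \<le> measure lam ({u \<in> I. \<bar>x u\<bar> > ?a} \<union> {u \<in> I. \<bar>y u\<bar> > ?b})"
    using sets_level[OF x] sets_level[OF y]
    by (intro finite_measure.finite_measure_mono[OF finite_measure_lam]) auto
  also have "\<dots> \<le> measure lam {u \<in> I. \<bar>x u\<bar> > ?a} + measure lam {u \<in> I. \<bar>y u\<bar> > ?b}"
    using sets_level[OF x] sets_level[OF y] by (intro measure_Un_le) auto
  also have "\<dots> \<le> t / 2 + t / 2"
    using rearr_le_iff[OF x t2 a] rearr_le_iff[OF y t2 b] by simp
  finally show ?thesis using rearr_le_iff[OF xy t, of "?a + ?b"] a b by simp
qed

lemma rearr_cmult:
  assumes x: "x \<in> borel_measurable lam" and t: "t > 0"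
  shows "rearr (\<lambda>u. c * x u) t \<le> \<bar>c\<bar> * rearr x t"
proof -
  let ?a = "rearr x t"
  have a: "?a \<ge> 0" using rearr_nonneg x t by auto
  have cx: "(\<lambda>u. c * x u) \<in> borel_measurable lam" using x by simp
  have "{u \<in> I. \<bar>c * x u\<bar> > \<bar>c\<bar> * ?a} \<subseteq> {u \<in> I. \<bar>x u\<bar> > ?a}"
    by (auto simp: abs_mult mult_less_cancel_left)
  then have "measure lam {u \<in> I. \<bar>c * x u\<bar> > \<bar>c\<bar> * ?a} \<le> measure lam {u \<in> I. \<bar>x u\<bar> > ?a}"
    by (intro finite_measure.finite_measure_mono[OF finite_measure_lam] sets_level[OF x])
  also have "\<dots> \<le> t" using rearr_le_iff[OF x t a] by simp
  finally show ?thesis using rearr_le_iff[OF cx t, of "\<bar>c\<bar> * ?a"] a by simp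
qed

text \<open>The form in which the hypothesis on \<open>f\<close> is used: it makes the level sets initial intervals, and it
  passes from \<open>f\<close> to the dilations of \<open>f\<close> and to \<open>p * f + q\<close> with \<open>p, q \<ge> 0\<close>.\<close>

definition decreasing :: "(real \<Rightarrow> real) \<Rightarrow> bool" where
  "decreasing f \<longleftrightarrow> f \<in> L1 \<and> (\<forall>t\<in>I. 0 \<le> f t) \<and> antimono_on I f"

lemma decreasingD:
  assumes "decreasing f"
  shows "f \<in> borel_measurable lam" "integrable lam f" "f \<in> L1"
    "\<And>t. 0 < t \<Longrightarrow> t \<le> 1 \<Longrightarrow> 0 \<le> f t"
    "\<And>t u. 0 < t \<Longrightarrow> t \<le> u \<Longrightarrow> u \<le> 1 \<Longrightarrow> f u \<le> f t"
  using assms by (auto simp: decreasing_def L1_def monotone_on_def)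

text \<open>Together the two parts sandwich the level set \<open>{f > s}\<close> between \<open>{0<..<d}\<close> and \<open>{0<..d}\<close>, where
  \<open>d\<close> is its measure.  All measures of level sets below are computed from this.\<close>

lemma decreasing_level:
  assumes f: "decreasing f"
  shows "u \<in> I \<Longrightarrow> s < f u \<Longrightarrow> u \<le> measure lam {u \<in> I. \<bar>f u\<bar> > s}"
    and "0 < u \<Longrightarrow> u < measure lam {u \<in> I. \<bar>f u\<bar> > s} \<Longrightarrow> s < f u"
proof -
  assume u: "u \<in> I" and s: "s < f u"
  have "{0<..u} \<subseteq> {u \<in> I. \<bar>f u\<bar> > s}"
  proof
    fix v assume v: "v \<in> {0<..u}"
    then have "f u \<le> f v" using decreasingD(5)[OF f, of v u] u by auto
    then show "v \<in> {u \<in> I. \<bar>f u\<bar> > s}" using u v s by auto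
  qed
  then have "measure lam {0<..u} \<le> measure lam {u \<in> I. \<bar>f u\<bar> > s}"
    by (intro finite_measure.finite_measure_mono[OF finite_measure_lam]
        sets_level[OF decreasingD(1)[OF f]])
  then show "u \<le> measure lam {u \<in> I. \<bar>f u\<bar> > s}"
    using measure_lam_greaterThanAtMost[of u] u by simp
next
  assume u: "0 < u" and d: "u < measure lam {u \<in> I. \<bar>f u\<bar> > s}"
  then have u1: "u < 1" using level_le_1[where f=f and s=s] by linarith
  show "s < f u"
  proof (rule ccontr)
    assume "\<not> ?thesis"
    then have le: "f v \<le> s" if "u \<le> v" "v \<le> 1" for v
      using decreasingD(5)[OF f u that] by linarith
    have "{v \<in> I. \<bar>f v\<bar> > s} \<subseteq> {0<..u}"
    proof
      fix v assume v: "v \<in> {v \<in> I. \<bar>f v\<bar> > s}"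
      then show "v \<in> {0<..u}" using le[of v] decreasingD(4)[OF f, of v] by (cases "v \<le> u") auto
    qed
    then have "measure lam {v \<in> I. \<bar>f v\<bar> > s} \<le> measure lam {0<..u}"
      using u1 by (intro finite_measure.finite_measure_mono[OF finite_measure_lam])
        (auto simp: sets_restrict_space_iff)
    then show False using d measure_lam_greaterThanAtMost[of u] u u1 by simp
  qed
qed

lemma rearr_decreasing_le:
  assumes f: "decreasing f" and t: "t \<in> I"
  shows "rearr f t \<le> f t"
proof (rule ccontr)
  assume "\<not> ?thesis"
  then have "t < measure lam {u \<in> I. \<bar>f u\<bar> > f t}"
    using rearr_greater_iff[OF decreasingD(1)[OF f], of t "f t"] decreasingD(4)[OF f] t by simp
  then show False using decreasing_level(2)[OF f, of t "f t"] t by simp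
qed

text \<open>Without right-continuity \<open>f t \<le> rearr f t\<close> may fail at jumps, hence the shift from \<open>t\<close> to
  a larger \<open>u\<close>.\<close>

lemma rearr_decreasing_ge:
  assumes f: "decreasing f" and t: "0 < t" "t < u" "u \<le> 1"
  shows "f u \<le> rearr f t"
proof (rule ccontr)
  assume c: "\<not> ?thesis"
  have "u \<le> measure lam {u \<in> I. \<bar>f u\<bar> > rearr f t}"
    by (rule decreasing_level(1)[OF f]) (use c t in auto)
  moreover have "measure lam {u \<in> I. \<bar>f u\<bar> > rearr f t} \<le> t"
    using rearr_le_iff[OF decreasingD(1)[OF f] t(1) rearr_nonneg[OF decreasingD(1)[OF f] t(1)]] by simp
  ultimately show False using t by simp
qed

section \<open>Comparing integrals through level sets\<close>

text \<open>Tonelli's theorem for the region under the graph of \<open>g\<close>.  On the left \<open>ennreal\<close> cuts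
  off the negative part of \<open>g\<close>; on the right this is done by the restriction to levels \<open>s \<ge> 0\<close>.\<close>

lemma nn_integral_layer_cake:
  fixes g :: "'a \<Rightarrow> real"
  assumes M: "sigma_finite_measure M" and g[measurable]: "g \<in> borel_measurable M"
  shows "(\<integral>\<^sup>+x. ennreal (g x) \<partial>M)
      = (\<integral>\<^sup>+s. indicator {0..} s * emeasure M {u \<in> space M. g u > s} \<partial>lborel)"
proof -
  interpret sigma_finite_measure M by (rule M)
  interpret pair_sigma_finite M lborel
    by (simp add: pair_sigma_finite_def M sigma_finite_lborel)
  have "(\<integral>\<^sup>+x. ennreal (g x) \<partial>M) = (\<integral>\<^sup>+x. (\<integral>\<^sup>+s. indicator {0..<g x} s \<partial>lborel) \<partial>M)"
  proof (rule nn_integral_cong)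
    fix x show "ennreal (g x) = (\<integral>\<^sup>+s. indicator {0..<g x} s \<partial>lborel)"
      by (cases "0 \<le> g x") (auto simp: ennreal_neg)
  qed
  also have "\<dots> = (\<integral>\<^sup>+x. (\<integral>\<^sup>+s. (if 0 \<le> s \<and> s < g x then 1 else 0) \<partial>lborel) \<partial>M)"
    by (intro nn_integral_cong) (auto simp: indicator_def)
  also have "\<dots> = (\<integral>\<^sup>+s. (\<integral>\<^sup>+x. (if 0 \<le> s \<and> s < g x then 1 else 0) \<partial>M) \<partial>lborel)"
    by (rule Fubini'[symmetric]) measurable
  also have "\<dots> = (\<integral>\<^sup>+s. indicator {0..} s * emeasure M {u \<in> space M. g u > s} \<partial>lborel)"
  proof (rule nn_integral_cong)
    fix s :: real
    have "(\<integral>\<^sup>+x. (if 0 \<le> s \<and> s < g x then 1 else 0) \<partial>M)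
        = (\<integral>\<^sup>+x. indicator {0..} s * indicator {u \<in> space M. g u > s} x \<partial>M)"
      by (intro nn_integral_cong) (auto simp: indicator_def)
    then show "(\<integral>\<^sup>+x. (if 0 \<le> s \<and> s < g x then 1 else 0) \<partial>M)
        = indicator {0..} s * emeasure M {u \<in> space M. g u > s}"
      by (simp add: nn_integral_cmult)
  qed
  finally show ?thesis .
qed

text \<open>This replaces all rearrangement inequalities for integrals, and also serves to
  transfer integrability from \<open>h\<close> to \<open>g\<close>.\<close>

lemma integral_le_of_levels:
  fixes g h :: "real \<Rightarrow> real"
  assumes g: "g \<in> borel_measurable lam" and h: "integrable lam h"
    and g0: "\<And>u. u \<in> I \<Longrightarrow> 0 \<le> g u" and h0: "\<And>u. u \<in> I \<Longrightarrow> 0 \<le> h u" and K: "0 \<le> K"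
    and le: "\<And>s. 0 \<le> s \<Longrightarrow> measure lam {u \<in> I. g u > s} \<le> K * measure lam {u \<in> I. h u > s}"
  shows "integrable lam g" and "(LINT u|lam. g u) \<le> K * (LINT u|lam. h u)"
proof -
  interpret finite_measure lam by (rule finite_measure_lam)
  have hm[measurable]: "h \<in> borel_measurable lam" using h by simp
  have sf: "sigma_finite_measure lam" by unfold_locales
  have "(\<integral>\<^sup>+x. ennreal (g x) \<partial>lam)
      \<le> (\<integral>\<^sup>+s. ennreal K * (indicator {0..} s * emeasure lam {u \<in> space lam. h u > s}) \<partial>lborel)"
    unfolding nn_integral_layer_cake[OF sf g]
  proof (rule nn_integral_mono)
    fix s :: real
    show "indicator {0..} s * emeasure lam {u \<in> space lam. g u > s}
        \<le> ennreal K * (indicator {0..} s * emeasure lam {u \<in> space lam. h u > s})"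
    proof (cases "0 \<le> s")
      case True
      then show ?thesis using le[OF True] K
        by (simp add: emeasure_eq_measure space_lebesgue_on flip: ennreal_mult)
    qed simp
  qed
  also have "\<dots> = ennreal K * (\<integral>\<^sup>+x. ennreal (h x) \<partial>lam)"
    unfolding nn_integral_layer_cake[OF sf hm] by (intro nn_integral_cmult) measurable
  also have "(\<integral>\<^sup>+x. ennreal (h x) \<partial>lam) = ennreal (LINT u|lam. h u)"
    using h h0 by (intro nn_integral_eq_integral) (auto simp: space_lebesgue_on)
  finally have *: "(\<integral>\<^sup>+x. ennreal (g x) \<partial>lam) \<le> ennreal (K * (LINT u|lam. h u))"
    using K by (simp add: ennreal_mult')
  show gi: "integrable lam g"
  proof (rule integrableI_nonneg[OF g])
    show "AE x in lam. 0 \<le> g x" using g0 by (auto simp: space_lebesgue_on)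
    show "(\<integral>\<^sup>+x. ennreal (g x) \<partial>lam) < \<infinity>" using * by (simp add: le_less_trans)
  qed
  have "(\<integral>\<^sup>+x. ennreal (g x) \<partial>lam) = ennreal (LINT u|lam. g u)"
    using gi g0 by (intro nn_integral_eq_integral) (auto simp: space_lebesgue_on)
  moreover have "0 \<le> (LINT u|lam. h u)"
    using h0 by (intro integral_nonneg_AE) (auto simp: space_lebesgue_on)
  ultimately show "(LINT u|lam. g u) \<le> K * (LINT u|lam. h u)"
    using * K by (simp add: ennreal_le_iff)
qed

section \<open>The principal ideal of a decreasing function\<close>

lemma level_mono_sets:
  assumes "A \<subseteq> B" "B \<in> sets lam"
  shows "measure lam A \<le> measure lam B"
  by (rule finite_measure.finite_measure_mono[OF finite_measure_lam assms])

lemma measure_lam_Ioc: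
  assumes "0 \<le> a" "a \<le> c" "c \<le> 1"
  shows "measure lam {a<..c} = c - a" "{a<..c} \<in> sets lam"
  using assms by (subst measure_restrict_space, auto simp: sets_restrict_space_iff)

lemma measure_lam_Ioo:
  assumes "0 \<le> a" "a \<le> c" "c \<le> 1"
  shows "measure lam {a<..<c} = c - a" "{a<..<c} \<in> sets lam"
  using assms by (subst measure_restrict_space, auto simp: sets_restrict_space_iff)

lemma sets_superlevel:
  fixes g :: "real \<Rightarrow> real"
  assumes "g \<in> borel_measurable lam"
  shows "{u \<in> I. s < g u} \<in> sets lam"
proof -
  have "{u \<in> space lam. s < g u} \<in> sets lam" using assms by measurable
  then show ?thesis by (simp only: space_lebesgue_on)
qed

lemma borel_measurable_id_lam: "(\<lambda>t::real. t) \<in> borel_measurable lam"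
  by (intro measurable_restrict_space1 measurable_completion) simp

lemma borel_measurable_lam_compose:
  assumes f: "antimono_on I f" and T: "T \<in> borel_measurable lam" "\<And>t. t \<in> I \<Longrightarrow> T t \<in> I"
  shows "(\<lambda>t. f (T t) :: real) \<in> borel_measurable lam"
proof -
  have "(\<lambda>t. - f t) \<in> borel_measurable (restrict_space borel I)"
    using f by (intro borel_measurable_mono_on_fnc) (auto simp: monotone_on_def)
  then have "f \<in> borel_measurable (restrict_space borel I)"
    using borel_measurable_uminus_eq by blast
  moreover have "T \<in> lam \<rightarrow>\<^sub>M restrict_space borel I"
    using T by (intro measurable_restrict_space2) (auto simp: space_lebesgue_on)
  ultimately show ?thesis using measurable_compose by blast
qed

text \<open>One half of the description of the principal ideal: minimality will give the inclusion from left to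
  right.\<close>

lemma symmetric_ideal_rearr_bounded:
  assumes f: "decreasing f"
  shows "symmetric_ideal {z \<in> L1. \<exists>q>1. \<forall>t\<in>I. rearr z t \<le> q * f (t / q) + q}" (is "symmetric_ideal ?S")
proof -
  \<comment> \<open>the bound weakens as \<open>q\<close> grows\<close>
  have enlarge: "q * f (t / q) + q \<le> q' * f (t / q') + q'" if "1 < q" "q \<le> q'" "t \<in> I" for q q' t
  proof -
    have *: "0 < t / q'" "t / q' \<le> t / q" "t / q \<le> 1" "0 < t / q"
      using that by (auto simp: field_simps mult_left_mono) 
    then have "f (t / q) \<le> f (t / q')" "0 \<le> f (t / q')"
      by (auto intro!: decreasingD(4,5)[OF f])
    then have "q * f (t / q) \<le> q' * f (t / q')" using that by (intro mult_mono') (auto intro!: decreasingD(4)[OF f] *)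
    then show ?thesis using that by simp
  qed
  have meas: "z \<in> borel_measurable lam" if "z \<in> L1" for z using that by (auto simp: L1_def)
  have A1: "Linf \<subseteq> ?S"
  proof
    fix x assume x: "x \<in> Linf"
    then have xL: "x \<in> L1" using symmetric_idealD(1)[OF symmetric_ideal_L1] by blast
    from x obtain C where C: "AE t in lam. \<bar>x t\<bar> \<le> C" by (auto simp: Linf_def)
    define q where "q = max C 2"
    have q: "q > 1" "q \<ge> C" "q \<ge> 0" by (auto simp: q_def)
    have "AE t in lam. t \<notin> {u \<in> I. \<bar>x u\<bar> > q}" using C by eventually_elim (use q in auto)
    then have 0: "measure lam {u \<in> I. \<bar>x u\<bar> > q} = 0"
      using sets_level[OF meas[OF xL], of q] by (subst (asm) AE_iff_null_sets[symmetric]) (auto simp: measure_def null_sets_def)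
    have "rearr x t \<le> q * f (t / q) + q" if t: "t \<in> I" for t
    proof -
      have "rearr x t \<le> q" using rearr_le_iff[OF meas[OF xL], of t q] 0 t q by auto
      moreover have "0 \<le> q * f (t / q)" using q t by (intro mult_nonneg_nonneg decreasingD(4)[OF f]) (auto simp: field_simps)
      ultimately show ?thesis by linarith
    qed
    then show "x \<in> ?S" using xL q by blast
  qed
  have A2: "?S \<subseteq> L1" by blast
  have A3: "(\<lambda>t. x t + y t) \<in> ?S" if x: "x \<in> ?S" and y: "y \<in> ?S" for x y
  proof -
    obtain q where q: "q > 1" "\<And>t. t \<in> I \<Longrightarrow> rearr x t \<le> q * f (t / q) + q" using x by blast
    obtain p where p: "p > 1" "\<And>t. t \<in> I \<Longrightarrow> rearr y t \<le> p * f (t / p) + p" using y by blast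
    define r where "r = max p q"
    have r: "r > 1" "q \<le> r" "p \<le> r" using q by (auto simp: r_def)
    have "rearr (\<lambda>t. x t + y t) t \<le> (2 * r) * f (t / (2 * r)) + 2 * r" if t: "t \<in> I" for t
    proof -
      have t2: "t / 2 \<in> I" using t by auto
      have "rearr (\<lambda>t. x t + y t) t \<le> rearr x (t / 2) + rearr y (t / 2)"
        using rearr_add meas x y t by auto
      also have "\<dots> \<le> (r * f (t / 2 / r) + r) + (r * f (t / 2 / r) + r)"
        using q(2)[OF t2] p(2)[OF t2] enlarge[OF q(1) r(2) t2] enlarge[OF p(1) r(3) t2] by linarith
      finally show ?thesis by (simp add: algebra_simps)
    qed
    moreover have "(\<lambda>t. x t + y t) \<in> L1" using x y symmetric_idealD(3)[OF symmetric_ideal_L1] by blast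
    moreover have "2 * r > 1" using r by simp
    ultimately show ?thesis by blast
  qed
  have A4: "(\<lambda>t. c * x t) \<in> ?S" if x: "x \<in> ?S" for c x
  proof -
    obtain q where q: "q > 1" "\<And>t. t \<in> I \<Longrightarrow> rearr x t \<le> q * f (t / q) + q" using x by blast
    define r where "r = (\<bar>c\<bar> + 1) * q"
    have r: "r > 1" "q \<le> r" "\<bar>c\<bar> * q \<le> r" 
    proof -
      have "0 \<le> \<bar>c\<bar> * q" using q by simp
      then show "r > 1" "q \<le> r" "\<bar>c\<bar> * q \<le> r" using q(1) unfolding r_def distrib_right mult_1 by linarith+
    qed
    have "rearr (\<lambda>t. c * x t) t \<le> r * f (t / r) + r" if t: "t \<in> I" for t
    proof -
      have "rearr (\<lambda>t. c * x t) t \<le> \<bar>c\<bar> * rearr x t"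
        using rearr_cmult meas x t by auto
      also have "\<dots> \<le> \<bar>c\<bar> * (q * f (t / q) + q)"
        using q(2)[OF t] by (intro mult_left_mono) auto
      also have "\<dots> = (\<bar>c\<bar> * q) * f (t / q) + \<bar>c\<bar> * q" by (simp add: algebra_simps)
      also have "\<dots> \<le> r * f (t / r) + r"
      proof (intro add_mono mult_mono)
        show "f (t / q) \<le> f (t / r)"
          using t q r by (intro decreasingD(5)[OF f]) (auto simp: field_simps)
        show "0 \<le> f (t / q)" using t q by (intro decreasingD(4)[OF f]) (auto simp: field_simps)
      qed (use r in auto)
      finally show ?thesis .
    qed
    moreover have "(\<lambda>t. c * x t) \<in> L1" using x symmetric_idealD(4)[OF symmetric_ideal_L1] by blast
    ultimately show ?thesis using r(1) by blast
  qed
  have A6: "y \<in> ?S" if x: "x \<in> ?S" and y: "y \<in> L1" "\<forall>t\<in>I. rearr y t \<le> rearr x t" for x y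
    using x y by (auto intro: order_trans)
  have A5: "y \<in> ?S" if x: "x \<in> ?S" and y: "y \<in> borel_measurable lam" "AE t in lam. \<bar>y t\<bar> \<le> \<bar>x t\<bar>" for x y
  proof (rule A6[OF x])
    have xL: "x \<in> L1" using x by blast
    show "y \<in> L1" using symmetric_idealD(5)[OF symmetric_ideal_L1 xL y] .
    show "\<forall>t\<in>I. rearr y t \<le> rearr x t"
    proof
      fix t assume t: "t \<in> I"
      show "rearr y t \<le> rearr x t"
      proof (rule rearr_mono[OF meas[OF xL] y(1)])
        fix s :: real
        show "measure lam {u \<in> I. \<bar>y u\<bar> > s} \<le> measure lam {u \<in> I. \<bar>x u\<bar> > s}"
        proof (rule finite_measure.finite_measure_mono_AE[OF finite_measure_lam])
          show "AE u in lam. u \<in> {u \<in> I. \<bar>y u\<bar> > s} \<longrightarrow> u \<in> {u \<in> I. \<bar>x u\<bar> > s}"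
            using y(2) by eventually_elim auto
          show "{u \<in> I. \<bar>x u\<bar> > s} \<in> sets lam" by (rule sets_level[OF meas[OF xL]])
        qed
      qed (use t in auto)
    qed
  qed
  show ?thesis unfolding symmetric_ideal_def
    by (intro conjI ballI allI impI) (fact A1 | fact A2 | erule (1) A3 | erule A4 | erule (2) A5 | erule (2) A6)+
qed

text \<open>The function \<open>t \<mapsto> f (t / 2)\<close> takes the values of \<open>f\<close> on \<open>{0<..1/2}\<close>, each twice as often.  It is therefore
  dominated in rearrangement by \<open>y1 + y2\<close>, where \<open>y1\<close> is \<open>f\<close> cut off at \<open>1/2\<close> and \<open>y2\<close> is the translate of
  \<open>y1\<close> to the right half of the interval.  Both are in the ideal, as \<open>y2\<close> has a smaller rearrangement
  than \<open>f\<close>.\<close>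

lemma decreasing_dilate_half:
  assumes f: "decreasing f" and X: "symmetric_ideal X" and fX: "f \<in> X"
  shows "decreasing (\<lambda>t. f (t / 2))" and "(\<lambda>t. f (t / 2)) \<in> X"
proof -
  have am: "antimono_on I f" using f by (simp add: decreasing_def)
  note id = borel_measurable_id_lam
  define e where "e s = measure lam {u \<in> I. \<bar>f u\<bar> > s}" for s
  have e: "0 \<le> e s" "e s \<le> 1" for s unfolding e_def by (rule measure_nonneg, rule level_le_1)
  have e1: "u \<le> e s" if "0 < u" "u \<le> 1" "s < f u" for u s
    unfolding e_def by (rule decreasing_level(1)[OF f]) (use that in auto)
  have e2: "s < f u" if "0 < u" "u < e s" for u s
    using decreasing_level(2)[OF f] that unfolding e_def by blast
  note pos = decreasingD(4)[OF f]
  let ?g = "\<lambda>t. f (t / 2)"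
  have gm: "?g \<in> borel_measurable lam"
    by (rule borel_measurable_lam_compose[OF am]) (use id in auto)
  define y1 where "y1 t = (if t \<le> 1/2 then f t else 0)" for t
  define y2 where "y2 t = (if t > 1/2 then f (t - 1/2) else 0)" for t
  have y1m: "y1 \<in> borel_measurable lam" unfolding y1_def
    by (intro measurable_If borel_measurable_const decreasingD(1)[OF f]) (use id in measurable)
  have y1X: "y1 \<in> X"
    by (rule symmetric_idealD(5)[OF X fX y1m]) (auto simp: y1_def)
  have "(\<lambda>t. f (if t > 1/2 then t - 1/2 else 1)) \<in> borel_measurable lam"
    by (rule borel_measurable_lam_compose[OF am]) (use id in \<open>auto simp: measurable_If\<close>)
  then have "(\<lambda>t. if t \<in> {1/2<..1} then f (if t > 1/2 then t - 1/2 else 1) else 0) \<in> borel_measurable lam"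
    by (intro measurable_If_set borel_measurable_const) (auto simp: sets_restrict_space_iff)
  then have y2m: "y2 \<in> borel_measurable lam"
    by (rule measurable_cong[THEN iffD1, rotated]) (auto simp: y2_def)
  have y2_level: "measure lam {u \<in> I. \<bar>y2 u\<bar> > s} \<le> e s" if s: "0 \<le> s" for s
  proof -
    have "{u \<in> I. \<bar>y2 u\<bar> > s} \<subseteq> {1/2<..1/2 + min (1/2) (e s)}"
      using e1[of "_ - 1/2" s] pos s by (force simp: y2_def split: if_splits)
    then have "measure lam {u \<in> I. \<bar>y2 u\<bar> > s} \<le> measure lam {1/2<..1/2 + min (1/2) (e s)}"
      by (rule level_mono_sets) (use e[of s] in \<open>auto intro!: measure_lam_Ioc\<close>)
    also have "\<dots> \<le> e s" using e[of s] by (subst measure_lam_Ioc) auto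
    finally show ?thesis .
  qed
  have "integrable lam (\<lambda>u. \<bar>y2 u\<bar>)"
  proof (rule integral_le_of_levels(1)[where K=1])
    show "integrable lam (\<lambda>u. \<bar>f u\<bar>)" using decreasingD(2)[OF f] by simp
  qed (use y2m y2_level in \<open>auto simp: e_def\<close>)
  then have y2L: "y2 \<in> L1" using y2m integrable_abs_cancel by (auto simp: L1_def)
  have "\<forall>t\<in>I. rearr y2 t \<le> rearr f t"
    using y2_level by (auto intro!: rearr_mono decreasingD(1)[OF f] y2m simp: e_def)
  then have y2X: "y2 \<in> X" by (rule symmetric_idealD(6)[OF X fX y2L])
  define y where "y t = y1 t + y2 t" for t
  have yX: "y \<in> X" unfolding y_def by (rule symmetric_idealD(3)[OF X y1X y2X])
  have ym: "y \<in> borel_measurable lam" unfolding y_def using y1m y2m by simp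
  have yi: "integrable lam y" using yX symmetric_idealD(2)[OF X] by (auto simp: L1_def)
  have lev: "measure lam {u \<in> I. \<bar>?g u\<bar> > s} \<le> measure lam {u \<in> I. \<bar>y u\<bar> > s}" if s: "0 \<le> s" for s
  proof -
    let ?d = "min (1/2) (e s)"
    have "{u \<in> I. \<bar>?g u\<bar> > s} \<subseteq> {0<..2 * ?d}"
      using e1[of "_ / 2" s] pos s by fastforce
    then have "measure lam {u \<in> I. \<bar>?g u\<bar> > s} \<le> measure lam {0<..2 * ?d}"
      by (rule level_mono_sets) (use e[of s] in \<open>auto intro!: measure_lam_Ioc\<close>)
    also have "\<dots> = ?d + ?d" using e[of s] by (subst measure_lam_Ioc) auto
    also have "\<dots> = measure lam {0<..<?d} + measure lam {1/2<..<1/2 + ?d}"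
      using e[of s] by (subst (1 2) measure_lam_Ioo) auto
    also have "\<dots> = measure lam ({0<..<?d} \<union> {1/2<..<1/2 + ?d})"
      using e[of s] by (intro finite_measure.finite_measure_Union[OF finite_measure_lam, symmetric] measure_lam_Ioo) auto
    also have "\<dots> \<le> measure lam {u \<in> I. \<bar>y u\<bar> > s}"
    proof (rule level_mono_sets[OF _ sets_level[OF ym]])
      show "{0<..<?d} \<union> {1/2<..<1/2 + ?d} \<subseteq> {u \<in> I. \<bar>y u\<bar> > s}"
      proof
        fix u assume "u \<in> {0<..<?d} \<union> {1/2<..<1/2 + ?d}"
        then consider "0 < u" "u < 1/2" "u < e s" | "1/2 < u" "u < 1" "u - 1/2 < e s" by force
        then show "u \<in> {u \<in> I. \<bar>y u\<bar> > s}"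
          using e2[of u s] e2[of "u - 1/2" s] by cases (auto simp: y_def y1_def y2_def)
      qed
    qed
    finally show ?thesis .
  qed
  have "integrable lam (\<lambda>u. \<bar>?g u\<bar>)"
  proof (rule integral_le_of_levels(1)[where K=1])
    show "integrable lam (\<lambda>u. \<bar>y u\<bar>)" using yi by simp
  qed (use gm lev in auto)
  then have gL: "?g \<in> L1" using gm integrable_abs_cancel by (auto simp: L1_def)
  then show "decreasing ?g" using pos decreasingD(5)[OF f]
    by (auto simp: decreasing_def monotone_on_def)
  have "\<forall>t\<in>I. rearr ?g t \<le> rearr y t"
    using lev by (auto intro!: rearr_mono gm ym)
  then show "?g \<in> X" by (rule symmetric_idealD(6)[OF X yX gL])
qed

lemma decreasing_dilate_power:
  assumes f: "decreasing f" and X: "symmetric_ideal X" and fX: "f \<in> X"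
  shows "decreasing (\<lambda>t. f (t / 2 ^ k)) \<and> (\<lambda>t. f (t / 2 ^ k)) \<in> X"
proof (induction k)
  case 0
  show ?case using f fX by simp
next
  case (Suc k)
  have "(\<lambda>t. f (t / 2 ^ Suc k)) = (\<lambda>t. f (t / 2 / 2 ^ k))" by simp
  then show ?case using decreasing_dilate_half[OF conjunct1[OF Suc] X conjunct2[OF Suc]] by presburger
qed

text \<open>For the inclusion from right to left, the dilation by \<open>q\<close> is majorised by a dilation by a
  power of \<open>2\<close>, obtained from repeated halving.\<close>

lemma principal_ideal_decreasing:
  assumes f: "decreasing f"
  shows "principal_ideal f = {z \<in> L1. \<exists>q>1. \<forall>t\<in>I. rearr z t \<le> q * f (t / q) + q}" (is "_ = ?S")
proof
  have fL: "f \<in> L1" using decreasingD(3)[OF f] .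
  note X = principal_ideal_least(1)[OF fL]
  note fX = principal_ideal_least(2)[OF fL]
  have "rearr f t \<le> 2 * f (t / 2) + 2" if t: "t \<in> I" for t
  proof -
    have "rearr f t \<le> f t" by (rule rearr_decreasing_le[OF f t])
    also have "f t \<le> f (t / 2)" using t by (intro decreasingD(5)[OF f]) auto
    finally show ?thesis using decreasingD(4)[OF f, of "t / 2"] t by simp
  qed
  then have "f \<in> ?S" using fL by (intro CollectI conjI exI[of _ 2]) auto
  then show "principal_ideal f \<subseteq> ?S"
    using principal_ideal_least(3)[OF fL symmetric_ideal_rearr_bounded[OF f]] by blast
  show "?S \<subseteq> principal_ideal f"
  proof
    fix z assume "z \<in> ?S"
    then obtain q where z: "z \<in> L1" and q: "q > 1" "\<And>t. t \<in> I \<Longrightarrow> rearr z t \<le> q * f (t / q) + q" by blast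
    obtain k where k: "q < 2 ^ k" using real_arch_pow[of 2 q] by auto
    have dX: "(\<lambda>t. f (t / 2 ^ k)) \<in> principal_ideal f" and dd: "decreasing (\<lambda>t. f (t / 2 ^ k))"
      using decreasing_dilate_power[OF f X fX] by auto
    let ?h = "\<lambda>t. q * f (t / 2 ^ k) + q"
    have "(\<lambda>t. q) \<in> Linf" by (auto simp: Linf_def)
    then have hX: "?h \<in> principal_ideal f"
      using symmetric_idealD(3)[OF X symmetric_idealD(4)[OF X dX]] symmetric_idealD(1)[OF X] by blast
    then have hL: "?h \<in> L1" using symmetric_idealD(2)[OF X] by blast
    have hd: "decreasing ?h" unfolding decreasing_def
      using hL q decreasingD(4,5)[OF dd] by (auto simp: monotone_on_def mult_left_mono)
    have "rearr z t \<le> rearr ?h t" if t: "t \<in> I" for t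
    proof (cases "t = 1")
      \<comment> \<open>no level set has measure greater than \<open>1\<close>, so \<open>rearr\<close> vanishes at the right end point\<close>
      case True
      have "rearr z 1 \<le> 0"
        using rearr_le_iff[of z 1 0] z level_le_1[where f=z and s=0] by (auto simp: L1_def)
      then show ?thesis using True rearr_nonneg[of ?h 1] hL by (auto simp: L1_def)
    next
      case False
      \<comment> \<open>\<open>u\<close> exceeds \<open>t\<close> because \<open>2 ^ k > q\<close>, which leaves room for a possible jump at \<open>t\<close>\<close>
      define u where "u = min 1 (t * 2 ^ k / q)"
      have u: "t < u" "u \<le> 1" "0 < t" using t False k q by (auto simp: u_def field_simps)
      have "u / 2 ^ k \<le> (t * 2 ^ k / q) / 2 ^ k" unfolding u_def by (intro divide_right_mono) auto
      then have *: "u / 2 ^ k \<le> t / q" by simp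
      have "f (t / q) \<le> f (u / 2 ^ k)"
        using * u q t by (intro decreasingD(5)[OF f]) (auto simp: field_simps)
      then have "q * f (t / q) + q \<le> ?h u" using q by simp
      also have "?h u \<le> rearr ?h t" by (rule rearr_decreasing_ge[OF hd u(3,1,2)])
      finally show ?thesis using q(2)[OF t] by simp
    qed
    then show "z \<in> principal_ideal f" by (intro symmetric_idealD(6)[OF X hX z]) blast
  qed
qed

section \<open>Interval partitions and their conditional expectations\<close>

lemma interval_partitionD:
  assumes b: "interval_partition b"
  shows "b 0 = 1" "m \<le> n \<Longrightarrow> b n \<le> b m" "m < n \<Longrightarrow> b n < b m" "0 < b n" "b n \<le> 1"
    "0 < e \<Longrightarrow> \<exists>N. \<forall>n\<ge>N. b n < e"
proof -
  have S: "b (Suc n) < b n" for n using b by (simp add: interval_partition_def)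
  show 0: "b 0 = 1" using b by (simp add: interval_partition_def)
  have dec: "decseq b" using S by (intro decseq_SucI less_imp_le)
  show "m \<le> n \<Longrightarrow> b n \<le> b m" using dec by (simp add: decseq_def)
  show "m < n \<Longrightarrow> b n < b m" using lift_Suc_mono_less[of "\<lambda>n. - b n"] S by simp
  have "0 \<le> b (Suc n)" using decseq_ge[OF dec] b by (simp add: interval_partition_def)
  then show "0 < b n" using S[of n] by linarith
  show "b n \<le> 1" using decseqD[OF dec, of 0 n] 0 by simp
  show "0 < e \<Longrightarrow> \<exists>N. \<forall>n\<ge>N. b n < e"
    using b order_tendstoD(2)[of b 0 sequentially e] by (auto simp: interval_partition_def eventually_sequentially)
qed

definition atom_index :: "(nat \<Rightarrow> real) \<Rightarrow> real \<Rightarrow> nat" where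
  "atom_index b u = (LEAST k. b (Suc k) < u)"

lemma atom_index:
  assumes b: "interval_partition b"
  shows "u \<in> I \<Longrightarrow> b (Suc (atom_index b u)) < u" "u \<in> I \<Longrightarrow> u \<le> b (atom_index b u)"
    "b (Suc k) < u \<Longrightarrow> u \<le> b k \<Longrightarrow> atom_index b u = k"
proof -
  note P = interval_partitionD[OF b]
  show 1: "b (Suc (atom_index b u)) < u" if u: "u \<in> I"
  proof -
    have "\<exists>k. b (Suc k) < u" using P(6)[of u] u by (metis greaterThanAtMost_iff le_SucI order_refl)
    then show ?thesis unfolding atom_index_def by (rule LeastI_ex)
  qed
  show 2: "u \<le> b (atom_index b u)" if u: "u \<in> I"
  proof (cases "atom_index b u")
    case (Suc k)
    then have "\<not> b (Suc k) < u" unfolding atom_index_def using not_less_Least by (metis lessI)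
    then show ?thesis using Suc by simp
  qed (use u P(1) in simp)
  assume k: "b (Suc k) < u" "u \<le> b k"
  then have "u \<in> I" using P(4)[of "Suc k"] P(5)[of k] by auto
  from 1[OF this] 2[OF this] k show "atom_index b u = k"
    using P(2)[of "Suc k" "atom_index b u"] P(2)[of "Suc (atom_index b u)" k]
    by (metis leD le_less_trans linorder_neqE_nat Suc_leI order_trans)
qed

lemma interval_partition_atom:
  assumes b: "interval_partition b"
  shows "{b (Suc k)<..b k} \<subseteq> I" "{b (Suc k)<..b k} \<in> sets lam"
    "measure lam {b (Suc k)<..b k} = b k - b (Suc k)"
    "{b (Suc k)<..b k} \<in> sets (partition_algebra b)"
proof -
  note P = interval_partitionD[OF b]
  show "{b (Suc k)<..b k} \<subseteq> I" using P(4)[of "Suc k"] P(5)[of k] by auto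
  show "{b (Suc k)<..b k} \<in> sets lam" "measure lam {b (Suc k)<..b k} = b k - b (Suc k)"
    using P(4)[of "Suc k"] P(5)[of k] P(2)[of k "Suc k"] by (auto intro!: measure_lam_Ioc)
  have sub: "range (\<lambda>n. {b (Suc n)<..b n}) \<union> null_sets lam \<subseteq> Pow I"
  proof -
    have "null_sets lam \<subseteq> Pow I"
      using sets.space_closed[of lam] by (auto simp only: space_lebesgue_on null_sets_def)
    moreover have "{b (Suc n)<..b n} \<subseteq> I" for n using P(4)[of "Suc n"] P(5)[of n] by auto
    ultimately show ?thesis by blast
  qed
  show "{b (Suc k)<..b k} \<in> sets (partition_algebra b)"
    unfolding partition_algebra_def using sub by (subst sets_measure_of) auto
qed

text \<open>The sets with this property contain the generators and are closed under complements and countable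
  unions.  For a union, either all members are null on the atom or one of them is already conull.\<close>

lemma partition_algebra_dichotomy:
  assumes b: "interval_partition b" and S: "S \<in> sets (partition_algebra b)"
  shows "{b (Suc k)<..b k} \<inter> S \<in> null_sets lam \<or> {b (Suc k)<..b k} - S \<in> null_sets lam"
proof -
  note P = interval_partitionD[OF b]
  let ?G = "range (\<lambda>n. {b (Suc n)<..b n}) \<union> null_sets lam"
  have G: "?G \<subseteq> Pow I" using interval_partition_atom(1)[OF b] sets.space_closed[of lam]
    by (auto simp only: space_lebesgue_on null_sets_def)
  have sG: "sets (partition_algebra b) = sigma_sets I ?G"
    unfolding partition_algebra_def using G by (rule sets_measure_of)
  let ?E = "{b (Suc k)<..b k}"
  have E: "?E \<in> sets lam" "?E \<subseteq> I" using interval_partition_atom[OF b] by blast+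
  have meas: "T \<in> sets lam" if "T \<in> sigma_sets I ?G" for T
    using subalgebra_partition_algebra[OF b] that unfolding subalgebra_def sG by blast
  from S have "S \<in> sigma_sets I ?G" unfolding sG .
  then show ?thesis
  proof (induction rule: sigma_sets.induct)
    case (Basic a)
    then consider n where "a = {b (Suc n)<..b n}" | "a \<in> null_sets lam" by blast
    then show ?case
    proof cases
      case 1
      show ?thesis
      proof (cases "n = k")
        case False
        then consider "Suc n \<le> k" | "Suc k \<le> n" by linarith
        then have "?E \<inter> a = {}" using P(2)[of "Suc n" k] P(2)[of "Suc k" n] 1 by cases auto
        then show ?thesis by simp
      qed (simp add: 1)
    next
      case 2
      then show ?thesis using null_set_Int1[OF _ E(1)] by blast
    qed
  next
    case Empty
    then show ?case by simp
  next
    case (Compl a)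
    have "?E \<inter> (I - a) = ?E - a" "?E - (I - a) = ?E \<inter> a" using E(2) by blast+
    then show ?case using Compl.IH by metis
  next
    case (Union a)
    have am: "a i \<in> sets lam" for i using meas Union.hyps by blast
    show ?case
    proof (cases "\<forall>i. ?E \<inter> a i \<in> null_sets lam")
      case True
      then have "(\<Union>i. ?E \<inter> a i) \<in> null_sets lam" by (intro null_sets_UN) auto
      then show ?thesis unfolding Int_UN_distrib by (rule disjI1)
    next
      case False
      then obtain i where "?E - a i \<in> null_sets lam" using Union.IH by blast
      moreover have "?E - (\<Union>i. a i) \<in> sets lam" using am E(1) by blast
      moreover have "?E - (\<Union>i. a i) \<subseteq> ?E - a i" by blast
      ultimately show ?thesis using null_sets_subset by blast
    qed
  qed
qed

lemma finite_measure_subalgebra_partition: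
  "interval_partition b \<Longrightarrow> finite_measure_subalgebra lam (partition_algebra b)"
  using finite_measure_lam subalgebra_partition_algebra
  by (simp add: finite_measure_subalgebra_def finite_measure_subalgebra_axioms_def)

text \<open>Where the conditional expectation lies below \<open>v\<close> is a set of the partition algebra.  If it were conull on
  the atom, the integral over the atom would be too small.\<close>

lemma cond_exp_ge_on_atom:
  assumes b: "interval_partition b" and x: "integrable lam x"
    and v: "v * (b k - b (Suc k)) \<le> (LINT u:{b (Suc k)<..b k}|lam. x u)"
  shows "AE u in lam. u \<in> {b (Suc k)<..b k} \<longrightarrow> v \<le> real_cond_exp lam (partition_algebra b) x u"
proof -
  let ?F = "partition_algebra b" and ?B = "{b (Suc k)<..b k}"
  interpret finite_measure_subalgebra lam ?F by (rule finite_measure_subalgebra_partition[OF b])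
  define E where "E = real_cond_exp lam ?F x"
  have Ei: "integrable lam E" unfolding E_def by (rule real_cond_exp_int(1)[OF x])
  note B = interval_partition_atom[OF b, of k]
  have spF: "space ?F = I" using subalgebra_partition_algebra[OF b] by (simp add: subalgebra_def space_lebesgue_on)
  define S where "S = {u \<in> space ?F. E u < v}"
  have S: "S \<in> sets ?F" unfolding S_def E_def by measurable
  have "?B \<inter> S \<in> null_sets lam"
  proof (rule ccontr)
    assume "?B \<inter> S \<notin> null_sets lam"
    then have N: "?B - S \<in> null_sets lam" using partition_algebra_dichotomy[OF b S] by blast
    define g where "g u = indicator ?B u *\<^sub>R v - indicator ?B u *\<^sub>R E u" for u
    have vi: "integrable lam (\<lambda>u. indicator ?B u *\<^sub>R v)" by (intro integrable_mult_indicator B integrable_const)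
    have gEi: "integrable lam (\<lambda>u. indicator ?B u *\<^sub>R E u)" by (intro integrable_mult_indicator B Ei)
    have gi: "integrable lam g" unfolding g_def by (intro Bochner_Integration.integrable_diff vi gEi)
    have notN: "AE u in lam. u \<notin> ?B - S" using N by (rule AE_not_in)
    have g0: "AE u in lam. 0 \<le> g u"
      using notN AE_space by eventually_elim (auto simp: g_def indicator_def S_def spF)
    have "(LINT u|lam. g u) = (b k - b (Suc k)) * v - (LINT u:?B|lam. E u)"
    proof -
      have "(LINT u|lam. indicator A u *\<^sub>R v) = measure lam A * v" if "A \<in> sets lam" for A
        using sets.sets_into_space[OF that] by (simp add: Int_absorb2)
      from this[OF B(2)] show ?thesis
        unfolding g_def set_lebesgue_integral_def Bochner_Integration.integral_diff[OF vi gEi] B(3) by simp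
    qed
    also have "(LINT u:?B|lam. E u) = (LINT u:?B|lam. x u)"
      unfolding E_def by (rule real_cond_exp_intA[OF x B(4), symmetric])
    finally have "(LINT u|lam. g u) \<le> 0" using v by (simp add: mult.commute)
    moreover have "0 \<le> (LINT u|lam. g u)" using g0 by (rule integral_nonneg_AE)
    ultimately have "AE u in lam. g u = 0" using integral_nonneg_eq_0_iff_AE[OF gi g0] by simp
    then have "AE u in lam. u \<notin> ?B"
      using notN AE_space by eventually_elim (use B(1) in \<open>auto simp: g_def indicator_def S_def spF\<close>)
    then have "?B \<in> null_sets lam" using AE_iff_null_sets[OF B(2)] by simp
    then have "measure lam ?B = 0" by (rule measure_eq_0_null_sets)
    then show False using B(3) interval_partitionD(3)[OF b, of k "Suc k"] by simp
  qed
  then have "AE u in lam. u \<notin> ?B \<inter> S" by (rule AE_not_in)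
  then show ?thesis using AE_space unfolding E_def[symmetric]
    by eventually_elim (use B(1) in \<open>auto simp: S_def spF not_less\<close>)
qed

section \<open>Sufficiency for monotonic partitions\<close>

text \<open>A quantitative form of $\int_A |z| \le \int_0^{|A|} z^*$.  The level \<open>q\<close> is split off \<open>\<bar>z\<bar>\<close> first; the bound on
  \<open>rearr z\<close> says that the remaining level sets are at most \<open>q\<close> times as large as those of \<open>q f\<close>.
  The factor \<open>2 * measure lam A / c\<close> compensates for integrating \<open>f\<close> over \<open>{0<..c}\<close> instead of
  \<open>{0<..measure lam A}\<close>; both \<open>c \<le> measure lam A\<close> and \<open>c\<close> up to twice that size occur.\<close>

lemma integral_rearr_bound:
  assumes f: "decreasing f" and z: "z \<in> L1" and q: "1 < q"
    and zq: "\<And>t. t \<in> I \<Longrightarrow> rearr z t \<le> q * f (t / q) + q"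
    and A: "A \<in> sets lam" and c: "c \<in> I" and cA: "c \<le> 2 * measure lam A"
  shows "(LINT u:A|lam. \<bar>z u\<bar>)
    \<le> measure lam A * (q + 2 * q\<^sup>2 * (LINT u:{0<..c}|lam. f u) / c)"
proof -
  interpret finite_measure lam by (rule finite_measure_lam)
  have zm[measurable]: "z \<in> borel_measurable lam" and zi: "integrable lam z" using z by (auto simp: L1_def)
  note [measurable] = A decreasingD(1)[OF f]
  have cs[measurable]: "{0<..c} \<in> sets lam" using c by (intro measure_lam_Ioc) auto
  let ?a = "measure lam A"
  let ?K = "2 * ?a * q / c"
  define g where "g u = indicator A u * max 0 (\<bar>z u\<bar> - q)" for u
  define h where "h u = indicator {0<..c} u * (q * f u)" for u
  have gm: "g \<in> borel_measurable lam" unfolding g_def by measurable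
  have hm: "h \<in> borel_measurable lam" unfolding h_def by measurable
  have fi: "integrable lam (\<lambda>u. indicator {0<..c} u *\<^sub>R f u)"
    by (intro integrable_mult_indicator cs decreasingD(2)[OF f])
  have h_eq: "h = (\<lambda>u. q * (indicator {0<..c} u *\<^sub>R f u))" by (auto simp: h_def fun_eq_iff)
  have hi: "integrable lam h" unfolding h_eq by (intro integrable_mult_right fi)
  have levels: "measure lam {u \<in> I. g u > s} \<le> ?K * measure lam {u \<in> I. h u > s}" if s: "0 \<le> s" for s
  proof -
    define d where "d = measure lam {u \<in> I. \<bar>z u\<bar> > s + q}"
    define e where "e = measure lam {u \<in> I. \<bar>f u\<bar> > s / q}"
    have d1: "d \<le> 1" unfolding d_def by (rule level_le_1)
    have e0: "0 \<le> e" unfolding e_def by simp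
    have e1: "e \<le> 1" unfolding e_def by (rule level_le_1)
    have de: "d \<le> q * e"
    proof (rule ccontr)
      assume "\<not> ?thesis"
      then obtain t where t: "q * e < t" "t < d" using dense[of "q * e" d] by auto
      have "0 \<le> q * e" using e0 q by simp
      then have tI: "t \<in> I" using t d1 by auto
      have "s + q < rearr z t"
        using rearr_greater_iff[OF zm, of t "s + q"] tI t s q by (auto simp: d_def)
      then have "s < q * f (t / q)" using zq[OF tI] by linarith
      then have "s / q < f (t / q)" using q by (simp add: field_simps)
      then have "t / q \<le> e" unfolding e_def
        using tI q by (intro decreasing_level(1)[OF f]) (auto simp: field_simps)
      then show False using t q by (simp add: field_simps)
    qed
    have "{u \<in> I. g u > s} \<subseteq> {u \<in> I. \<bar>z u\<bar> > s + q}" "{u \<in> I. g u > s} \<subseteq> A"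
      using s by (auto simp: g_def indicator_def split: if_splits)
    then have "measure lam {u \<in> I. g u > s} \<le> d" "measure lam {u \<in> I. g u > s} \<le> ?a"
      unfolding d_def by (blast intro: level_mono_sets sets_level[OF zm] A)+
    moreover have "min ?a d \<le> ?K * min c e"
    proof (cases "e \<le> c")
      case True
      have "min ?a d \<le> q * e * 1" using de by simp
      also have "\<dots> \<le> q * e * (2 * ?a / c)"
        using cA c e0 q by (intro mult_left_mono) (auto simp: field_simps)
      also have "\<dots> = ?K * min c e" using True by simp
      finally show ?thesis .
    next
      case False
      have "?a * 1 \<le> ?a * (2 * q)" using q by (intro mult_left_mono) auto
      then show ?thesis using False c by (simp add: min_def)
    qed
    moreover have "min c e \<le> measure lam {u \<in> I. h u > s}"
    proof -
      have "{0<..<min c e} \<subseteq> {u \<in> I. h u > s}"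
      proof
        fix u assume u: "u \<in> {0<..<min c e}"
        then have "s / q < f u" using decreasing_level(2)[OF f, of u "s / q"] by (auto simp: e_def)
        then have "s < q * f u" using q by (simp add: field_simps)
        then show "u \<in> {u \<in> I. h u > s}" using u c by (auto simp: h_def)
      qed
      moreover have "{u \<in> I. h u > s} \<in> sets lam" by (rule sets_superlevel[OF hm])
      ultimately have "measure lam {0<..<min c e} \<le> measure lam {u \<in> I. h u > s}"
        by (rule level_mono_sets)
      then show ?thesis using measure_lam_Ioo[of 0 "min c e"] c e0 e1 by auto
    qed
    moreover have "0 \<le> ?K" using q c by auto
    ultimately show ?thesis
      by (smt (verit, best) mult_left_mono)
  qed
  have K0: "0 \<le> ?K" using q c by auto
  have h0: "0 \<le> h u" if "u \<in> I" for u
    using decreasingD(4)[OF f, of u] that q by (auto simp: h_def indicator_def)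
  have g0: "0 \<le> g u" for u by (auto simp: g_def indicator_def)
  have gi: "integrable lam g" and gh: "(LINT u|lam. g u) \<le> ?K * (LINT u|lam. h u)"
    using integral_le_of_levels[OF gm hi g0 h0 K0 levels] by auto
  have qi: "integrable lam (\<lambda>u. indicator A u * q)"
    using integrable_mult_indicator[OF A integrable_const[of q]] by (simp only: real_scaleR_def)
  have "(LINT u:A|lam. \<bar>z u\<bar>) \<le> (LINT u|lam. indicator A u * q + g u)"
    unfolding set_lebesgue_integral_def
    by (intro integral_mono Bochner_Integration.integrable_add qi gi integrable_mult_indicator A integrable_abs zi)
      (auto simp: g_def indicator_def)
  also have "\<dots> = ?a * q + (LINT u|lam. g u)"
    using qi gi A sets.sets_into_space[OF A] by (subst Bochner_Integration.integral_add) (auto simp: Int_absorb2)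
  also have "(LINT u|lam. g u) \<le> ?K * (q * (LINT u:{0<..c}|lam. f u))"
    using gh unfolding h_eq set_lebesgue_integral_def by simp
  finally show ?thesis by (simp add: algebra_simps power2_eq_square)
qed

text \<open>The index \<open>n\<close> with \<open>b (Suc n) \<le> t < b n\<close> may be \<open>0\<close>, where \<open>b 0 = 1\<close> and the hypothesis says
  nothing.  The integral of \<open>f\<close> over all of \<open>I\<close> is therefore added to the constant \<open>r\<close>.\<close>

lemma averages_principal_ideal:
  assumes f: "decreasing f" and b: "interval_partition b" and mb: "monotonic_partition b"
    and Q: "1 < Q" "\<And>n. 1 \<le> n \<Longrightarrow> (LINT u:{0<..b n}|lam. f u) / b n \<le> Q * f (b n / Q)"
  shows "averages (partition_algebra b) (principal_ideal f)"
  unfolding averages_def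
proof
  note P = interval_partitionD[OF b]
  let ?F = "partition_algebra b"
  interpret finite_measure_subalgebra lam ?F by (rule finite_measure_subalgebra_partition[OF b])
  define J where "J c = (LINT u:{0<..c}|lam. f u)" for c
  fix x assume "x \<in> principal_ideal f"
  then obtain q where x: "x \<in> L1" and q: "1 < q" "\<And>t. t \<in> I \<Longrightarrow> rearr x t \<le> q * f (t / q) + q"
    unfolding principal_ideal_decreasing[OF f] by blast
  have xi: "integrable lam x" using x by (simp add: L1_def)
  define E where "E = real_cond_exp lam ?F x"
  have Ei: "integrable lam E" unfolding E_def by (rule real_cond_exp_int(1)[OF xi])
  then have EL: "E \<in> L1" and Em: "E \<in> borel_measurable lam" by (auto simp: L1_def)
  have J0: "0 \<le> J 1" unfolding J_def set_lebesgue_integral_def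
    using decreasingD(4)[OF f] by (intro integral_nonneg_AE) (auto simp: indicator_def space_lebesgue_on)
  define r where "r = Q + 2 * q\<^sup>2 * Q + q + 2 * q\<^sup>2 * J 1"
  have qq: "0 \<le> 2 * q\<^sup>2 * Q" "0 \<le> 2 * q\<^sup>2 * J 1" "0 < 2 * q\<^sup>2" using q Q J0 by auto
  have r: "1 < r" "Q \<le> r" "2 * q\<^sup>2 * Q \<le> r" "q + 2 * q\<^sup>2 * J 1 < r"
    using q Q qq unfolding r_def by linarith+
  have "rearr E t \<le> r * f (t / r) + r" if t: "t \<in> I" for t
  proof (rule ccontr)
    assume nle: "\<not> ?thesis"
    let ?s = "r * f (t / r) + r"
    have fr: "0 \<le> f (t / r)" using t r by (intro decreasingD(4)[OF f]) (auto simp: field_simps)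
    have s0: "0 \<le> ?s" using fr r by (intro add_nonneg_nonneg mult_nonneg_nonneg) auto
    define A where "A = {u \<in> I. \<bar>E u\<bar> > ?s}"
    have A: "A \<in> sets lam" unfolding A_def by (rule sets_level[OF Em])
    have AF: "A \<in> sets ?F"
    proof -
      have "{u \<in> space ?F. \<bar>E u\<bar> > ?s} \<in> sets ?F" unfolding E_def by measurable
      moreover have "space ?F = I" using subalgebra_partition_algebra[OF b]
        by (simp add: subalgebra_def space_lebesgue_on)
      ultimately show ?thesis unfolding A_def by simp
    qed
    have tA: "t < measure lam A"
      using nle rearr_greater_iff[OF Em, of t ?s] t s0 by (auto simp: A_def)
    then have t1: "t < 1" using level_le_1[where f=E and s="?s"] unfolding A_def by linarith
    define n where "n = (LEAST k. b (Suc k) \<le> t)"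
    have "\<exists>k. b (Suc k) \<le> t" using P(6)[of t] t by (metis greaterThanAtMost_iff le_SucI less_imp_le order_refl)
    then have n1: "b (Suc n) \<le> t" unfolding n_def by (rule LeastI_ex)
    have n2: "t < b n"
    proof (cases n)
      case (Suc k)
      then have "\<not> b (Suc k) \<le> t" unfolding n_def using not_less_Least by (metis lessI)
      then show ?thesis using Suc by simp
    qed (use t1 P(1) in simp)
    \<comment> \<open>Otherwise \<open>A\<close> would lie in \<open>{0<..b (Suc n)}\<close> up to a null set and be too small.\<close>
    obtain k where k: "k \<le> n" "{b (Suc k)<..b k} \<inter> A \<notin> null_sets lam"
    proof (rule ccontr)
      assume c: "\<not> thesis"
      have cover: "A \<subseteq> {0<..b (Suc n)} \<union> (\<Union>k\<le>n. {b (Suc k)<..b k} \<inter> A)"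
      proof
        fix u assume u: "u \<in> A"
        then have uI: "u \<in> I" by (simp add: A_def)
        show "u \<in> {0<..b (Suc n)} \<union> (\<Union>k\<le>n. {b (Suc k)<..b k} \<inter> A)"
        proof (cases "u \<le> b (Suc n)")
          case False
          define l where "l = atom_index b u"
          have l: "b (Suc l) < u" "u \<le> b l" unfolding l_def using atom_index[OF b] uI by auto
          have "l \<le> n"
            using False l(2) P(2)[of "Suc n" l] by (metis not_less_eq_eq order_trans)
          then show ?thesis using l u by auto
        qed (use uI in auto)
      qed
      have N: "(\<Union>k\<le>n. {b (Suc k)<..b k} \<inter> A) \<in> null_sets lam"
        using c that by (intro null_sets_UN') auto
      have I1: "{0<..b (Suc n)} \<in> sets lam" "measure lam {0<..b (Suc n)} = b (Suc n)"
        using P(4,5)[of "Suc n"] by (auto simp: measure_lam_greaterThanAtMost sets_restrict_space_iff)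
      have "measure lam A \<le> measure lam ({0<..b (Suc n)} \<union> (\<Union>k\<le>n. {b (Suc k)<..b k} \<inter> A))"
        using N I1 by (intro level_mono_sets[OF cover]) auto
      also have "\<dots> = b (Suc n)" using measure_Un_null_set[OF I1(1) N] I1(2) by simp
      finally show False using tA n1 by simp
    qed
    let ?D = "{b (Suc k)<..b k}"
    have "?D - A \<in> null_sets lam" using partition_algebra_dichotomy[OF b AF] k(2) by blast
    then have "measure lam (?D - A) = 0" by (rule measure_eq_0_null_sets)
    moreover have "measure lam (?D - A) = measure lam ?D - measure lam (?D \<inter> A)"
      by (rule finite_measure_Diff'[OF interval_partition_atom(2)[OF b] A])
    moreover have "measure lam (?D \<inter> A) \<le> measure lam A" by (rule level_mono_sets[OF _ A]) auto
    ultimately have "b k - b (Suc k) \<le> measure lam A" using interval_partition_atom(3)[OF b] by simp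
    moreover have "b n - b (Suc n) \<le> b k - b (Suc k)"
      using mb k(1) by (auto simp: monotonic_partition_def decseq_def)
    ultimately have half: "b n \<le> 2 * measure lam A" using tA n1 by linarith
    have bn: "b n \<in> I" using P by auto
    have absi: "integrable lam (\<lambda>u. \<bar>x u\<bar>)" using xi by simp
    let ?Ea = "real_cond_exp lam ?F (\<lambda>u. \<bar>x u\<bar>)"
    \<comment> \<open>\<open>\<bar>E\<bar>\<close> is bounded by the conditional expectation of \<open>\<bar>x\<bar>\<close>, since \<open>\<plusminus>x \<le> \<bar>x\<bar>\<close>\<close>
    have m1: "AE u in lam. E u \<le> ?Ea u" unfolding E_def
      by (rule real_cond_exp_mono) (use xi absi in auto)
    have m2: "AE u in lam. real_cond_exp lam ?F (\<lambda>u. - 1 * x u) u \<le> ?Ea u"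
      by (rule real_cond_exp_mono) (use xi absi in auto)
    have m3: "AE u in lam. real_cond_exp lam ?F (\<lambda>u. - 1 * x u) u = - 1 * E u" unfolding E_def
      by (rule real_cond_exp_cmult[OF xi])
    have m: "AE u in lam. \<bar>E u\<bar> \<le> ?Ea u" using m1 m2 m3 by eventually_elim auto
    have "?s * measure lam A = (LINT u:A|lam. ?s)"
      using A sets.sets_into_space[OF A] by (simp add: set_lebesgue_integral_def Int_absorb2)
    also have "\<dots> \<le> (LINT u:A|lam. ?Ea u)" unfolding set_lebesgue_integral_def
    proof (rule integral_mono_AE)
      show "integrable lam (\<lambda>u. indicator A u *\<^sub>R ?s)" by (intro integrable_mult_indicator A integrable_const)
      show "integrable lam (\<lambda>u. indicator A u *\<^sub>R ?Ea u)"
        by (intro integrable_mult_indicator A real_cond_exp_int(1) absi)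
      show "AE u in lam. indicator A u *\<^sub>R ?s \<le> indicator A u *\<^sub>R ?Ea u"
        using m by eventually_elim (auto simp: indicator_def A_def)
    qed
    also have "\<dots> = (LINT u:A|lam. \<bar>x u\<bar>)" by (rule real_cond_exp_intA[OF absi AF, symmetric])
    also have "\<dots> \<le> measure lam A * (q + 2 * q\<^sup>2 * J (b n) / b n)"
      unfolding J_def by (rule integral_rearr_bound[OF f x q A bn half])
    finally have "measure lam A * ?s \<le> measure lam A * (q + 2 * q\<^sup>2 * J (b n) / b n)" by (simp add: mult.commute)
    then have "?s \<le> q + 2 * q\<^sup>2 * (J (b n) / b n)" using tA t by simp
    moreover have fQ: "0 \<le> f (t / Q)" using t Q by (intro decreasingD(4)[OF f]) (auto simp: field_simps)
    have "J (b n) / b n \<le> Q * f (t / Q) + J 1"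
    proof (cases "n = 0")
      case True
      then show ?thesis using P(1) fQ Q by simp
    next
      case False
      have "f (b n / Q) \<le> f (t / Q)"
        using t n2 Q P(5)[of n] by (intro decreasingD(5)[OF f]) (auto simp: field_simps)
      then have "Q * f (b n / Q) \<le> Q * f (t / Q)" using Q by simp
      then show ?thesis using Q(2)[of n] False J0 by (simp add: J_def)
    qed
    then have "2 * q\<^sup>2 * (J (b n) / b n) \<le> 2 * q\<^sup>2 * (Q * f (t / Q) + J 1)"
      by (intro mult_left_mono) auto
    moreover have "(2 * q\<^sup>2 * Q) * f (t / Q) \<le> r * f (t / r)"
    proof (intro mult_mono)
      show "f (t / Q) \<le> f (t / r)" using t Q r by (intro decreasingD(5)[OF f]) (auto simp: field_simps)
    qed (use r fQ in auto)
    ultimately show False using r(4) by (simp add: algebra_simps)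
  qed
  then show "E \<in> principal_ideal f" unfolding principal_ideal_decreasing[OF f] using EL r(1) by blast
qed

section \<open>Spreading a decreasing function over the atoms of each block\<close>

lemma measurable_atom_index: "atom_index b \<in> lam \<rightarrow>\<^sub>M count_space UNIV"
proof -
  note [measurable] = borel_measurable_id_lam
  show ?thesis unfolding atom_index_def[abs_def] by (intro measurable_Least) measurable
qed

text \<open>The sequence \<open>c\<close> is meant to be a subsequence of \<open>b\<close>, so that its atoms, the blocks, are unions of atoms
  of \<open>b\<close>.  The function is affine on each atom of \<open>b\<close> and maps it onto the surrounding block.\<close>

definition spread :: "(nat \<Rightarrow> real) \<Rightarrow> (nat \<Rightarrow> real) \<Rightarrow> real \<Rightarrow> real" where
  "spread b c t = (let k = atom_index b t; j = atom_index c t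
     in c (Suc j) + (t - b (Suc k)) * ((c j - c (Suc j)) / (b k - b (Suc k))))"

lemma borel_measurable_spread: "spread b c \<in> borel_measurable lam"
proof -
  define G where "G j k t = c (Suc j) + (t - b (Suc k)) * ((c j - c (Suc j)) / (b k - b (Suc k)))" for j k t
  have 1: "G j k \<in> borel_measurable lam" for j k
    unfolding G_def by (intro borel_measurable_add borel_measurable_times borel_measurable_diff
        borel_measurable_const borel_measurable_id_lam)
  have 2: "(\<lambda>t. G j (atom_index b t) t) \<in> borel_measurable lam" for j
    by (rule measurable_compose_countable[where f="G j", OF 1 measurable_atom_index])
  have "(\<lambda>t. G (atom_index c t) (atom_index b t) t) \<in> borel_measurable lam"
    by (rule measurable_compose_countable[where f="\<lambda>j t. G j (atom_index b t) t", OF 2 measurable_atom_index])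
  then show ?thesis by (simp add: spread_def[abs_def] Let_def G_def)
qed

lemma spread_atom:
  assumes b: "interval_partition b" and c: "interval_partition c"
    and k: "b (Suc k) < t" "t \<le> b k" and j: "c (Suc j) < t" "t \<le> c j"
  shows "spread b c t = c (Suc j) + (t - b (Suc k)) * ((c j - c (Suc j)) / (b k - b (Suc k)))"
    and "c (Suc j) < spread b c t" "spread b c t \<le> c j"
    and "spread b c t \<le> d \<longleftrightarrow> t \<le> b (Suc k) + (b k - b (Suc k)) * ((d - c (Suc j)) / (c j - c (Suc j)))"
proof -
  show eq: "spread b c t = c (Suc j) + (t - b (Suc k)) * ((c j - c (Suc j)) / (b k - b (Suc k)))"
    unfolding spread_def Let_def atom_index(3)[OF b k] atom_index(3)[OF c j] ..
  have B: "0 < b k - b (Suc k)" and C: "0 < c j - c (Suc j)"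
    using interval_partitionD(3)[OF b, of k "Suc k"] interval_partitionD(3)[OF c, of j "Suc j"] by auto
  show "c (Suc j) < spread b c t" unfolding eq using B C k by simp
  have "(t - b (Suc k)) * ((c j - c (Suc j)) / (b k - b (Suc k)))
      \<le> (b k - b (Suc k)) * ((c j - c (Suc j)) / (b k - b (Suc k)))"
    using B C k by (intro mult_right_mono) auto
  then show "spread b c t \<le> c j" unfolding eq using B by simp
  have "spread b c t \<le> d \<longleftrightarrow> (t - b (Suc k)) * (c j - c (Suc j)) \<le> (d - c (Suc j)) * (b k - b (Suc k))"
    unfolding eq using B by (simp add: field_simps)
  also have "\<dots> \<longleftrightarrow> t - b (Suc k) \<le> (b k - b (Suc k)) * ((d - c (Suc j)) / (c j - c (Suc j)))"
    using C by (simp add: pos_le_divide_eq mult.commute)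
  finally show "spread b c t \<le> d \<longleftrightarrow> t \<le> b (Suc k) + (b k - b (Suc k)) * ((d - c (Suc j)) / (c j - c (Suc j)))"
    by linarith
qed

lemma spread_in_I:
  assumes b: "interval_partition b" and c: "interval_partition c" and t: "t \<in> I"
  shows "spread b c t \<in> I"
  using spread_atom(2,3)[OF b c atom_index(1,2)[OF b t] atom_index(1,2)[OF c t]]
    interval_partitionD(4,5)[OF c] by (smt (verit, best) greaterThanAtMost_iff)

lemma interval_partition_subseq:
  assumes b: "interval_partition b" and r: "strict_mono r" "r 0 = (0::nat)"
  shows "interval_partition (\<lambda>j. b (r j))"
proof -
  have "(b \<circ> r) \<longlonglongrightarrow> 0"
    using b r(1) LIMSEQ_subseq_LIMSEQ unfolding interval_partition_def by blast
  then show ?thesis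
    using interval_partitionD[OF b] r strict_monoD[OF r(1)]
    by (auto simp: interval_partition_def comp_def)
qed

text \<open>Let \<open>d\<close> be in the block \<open>{l<..h}\<close>.  Points of higher blocks are mapped above \<open>d\<close>, and there are only
  \<open>l\<close> worth of points in lower blocks.  In the block itself the same fraction \<open>(d - l) / (h - l)\<close> of every
  atom is mapped below \<open>d\<close>; these fractions add up to \<open>d - l\<close>.\<close>

lemma measure_spread_le:
  assumes b: "interval_partition b" and r: "strict_mono r" "r 0 = (0::nat)" and d: "d \<in> I"
  shows "measure lam {t \<in> I. spread b (\<lambda>j. b (r j)) t \<le> d} \<le> d"
proof -
  define c where "c j = b (r j)" for j
  have c: "interval_partition c" unfolding c_def by (rule interval_partition_subseq[OF b r])
  note P = interval_partitionD[OF b] and C = interval_partitionD[OF c]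
  define j where "j = atom_index c d"
  have j: "c (Suc j) < d" "d \<le> c j" unfolding j_def using atom_index[OF c] d by auto
  let ?K = "{r j..<r (Suc j)}"
  define w where "w = (d - c (Suc j)) / (c j - c (Suc j))"
  have w: "0 \<le> w" "w \<le> 1" unfolding w_def using j by auto
  define D where "D k = {b (Suc k)<..b (Suc k) + (b k - b (Suc k)) * w}" for k
  have D: "D k \<in> sets lam" "measure lam (D k) = (b k - b (Suc k)) * w" for k
  proof -
    have 1: "(b k - b (Suc k)) * w \<le> (b k - b (Suc k)) * 1" using w P(2)[of k "Suc k"] by (intro mult_left_mono) auto
    have 2: "0 \<le> (b k - b (Suc k)) * w" using w P(2)[of k "Suc k"] by auto
    have 3: "0 \<le> b (Suc k)" "b (Suc k) \<le> b (Suc k) + (b k - b (Suc k)) * w" "b (Suc k) + (b k - b (Suc k)) * w \<le> 1"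
      using 1 2 P(4)[of "Suc k"] P(5)[of k] by auto
    show "D k \<in> sets lam" "measure lam (D k) = (b k - b (Suc k)) * w"
      unfolding D_def using measure_lam_Ioc[OF 3] by auto
  qed
  have lo: "{0<..c (Suc j)} \<in> sets lam" "measure lam {0<..c (Suc j)} = c (Suc j)"
    using measure_lam_Ioc[of 0 "c (Suc j)"] C(4,5)[of "Suc j"] by auto
  have "{t \<in> I. spread b c t \<le> d} \<subseteq> {0<..c (Suc j)} \<union> (\<Union>k\<in>?K. D k)"
  proof
    fix t assume "t \<in> {t \<in> I. spread b c t \<le> d}"
    then have t: "t \<in> I" "spread b c t \<le> d" by auto
    show "t \<in> {0<..c (Suc j)} \<union> (\<Union>k\<in>?K. D k)"
    proof (cases "t \<le> c (Suc j)")
      case False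
      define i where "i = atom_index c t"
      have i: "c (Suc i) < t" "t \<le> c i" unfolding i_def using atom_index[OF c] t by auto
      define k where "k = atom_index b t"
      have k: "b (Suc k) < t" "t \<le> b k" unfolding k_def using atom_index[OF b] t by auto
      have "i \<le> j" using False i C(2)[of "Suc j" i] by (metis not_less_eq_eq order_trans)
      moreover have "\<not> i < j"
      proof
        assume "i < j"
        then have "c j \<le> c (Suc i)" using C(2)[of "Suc i" j] by simp
        then show False using spread_atom(2)[OF b c k i] t(2) j by linarith
      qed
      ultimately have ij: "i = j" by simp
      have "t \<in> D k" using spread_atom(4)[OF b c k i, of d] t(2) k unfolding D_def w_def ij by simp
      moreover have "r j \<le> k"
        using i(2) k(1) P(2)[of "Suc k" "r j"] unfolding ij c_def by (metis leD not_less_eq_eq order_less_le_trans)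
      moreover have "k < r (Suc j)"
        using i(1) k(2) P(2)[of "r (Suc j)" k] unfolding ij c_def by (metis leD not_le_imp_less order_trans)
      ultimately show ?thesis by auto
    qed (use t in auto)
  qed
  then have "measure lam {t \<in> I. spread b c t \<le> d} \<le> measure lam ({0<..c (Suc j)} \<union> (\<Union>k\<in>?K. D k))"
    using lo D by (intro level_mono_sets) auto
  also have "\<dots> \<le> c (Suc j) + measure lam (\<Union>k\<in>?K. D k)"
    using lo D measure_Un_le[of "{0<..c (Suc j)}" lam "\<Union>k\<in>?K. D k"] by auto
  also have "measure lam (\<Union>k\<in>?K. D k) \<le> (\<Sum>k\<in>?K. measure lam (D k))"
    using D by (intro measure_UNION_le) auto
  also have "\<dots> = (\<Sum>k\<in>?K. b k - b (Suc k)) * w" unfolding D(2) sum_distrib_right ..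
  also have "(\<Sum>k\<in>?K. b k - b (Suc k)) = c j - c (Suc j)"
    using sum_Suc_diff'[of "r j" "r (Suc j)" "\<lambda>k. - b k"] strict_monoD[OF r(1), of j "Suc j"]
    by (simp add: c_def)
  also have "c (Suc j) + (c j - c (Suc j)) * w = d" unfolding w_def using j by simp
  finally show ?thesis by (simp add: c_def[abs_def])
qed

text \<open>By the previous estimate, \<open>f \<circ> spread\<close> does not have larger level sets than \<open>f\<close>.\<close>

lemma spread_in_principal_ideal:
  assumes f: "decreasing f" and b: "interval_partition b" and r: "strict_mono r" "r 0 = (0::nat)"
  shows "(\<lambda>t. f (spread b (\<lambda>j. b (r j)) t)) \<in> principal_ideal f"
proof -
  let ?T = "spread b (\<lambda>j. b (r j))"
  have T: "?T t \<in> I" if "t \<in> I" for t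
    using spread_in_I[OF b interval_partition_subseq[OF b r] that] .
  have zm: "(\<lambda>t. f (?T t)) \<in> borel_measurable lam"
    by (rule borel_measurable_lam_compose[OF _ borel_measurable_spread T]) (use f in \<open>simp add: decreasing_def\<close>)
  have lev: "measure lam {t \<in> I. \<bar>f (?T t)\<bar> > s} \<le> measure lam {t \<in> I. \<bar>f t\<bar> > s}" (is "_ \<le> ?e") for s
  proof (cases "s < 0")
    case True
    then have "{t \<in> I. \<bar>f (?T t)\<bar> > s} = {t \<in> I. \<bar>f t\<bar> > s}" by auto
    then show ?thesis by simp
  next
    case False
    have sub: "?T t \<le> ?e" if "t \<in> I" "\<bar>f (?T t)\<bar> > s" for t
      using decreasing_level(1)[OF f T] that decreasingD(4)[OF f, of "?T t"] T[OF that(1)] by auto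
    show ?thesis
    proof (cases "?e = 0")
      case True
      have "{t \<in> I. \<bar>f (?T t)\<bar> > s} = {}" using sub T True by force
      show ?thesis unfolding \<open>{t \<in> I. \<bar>f (?T t)\<bar> > s} = {}\<close> by simp
    next
      case False
      then have e: "?e \<in> I" using level_le_1[where f=f and s=s] measure_nonneg[of lam "{t \<in> I. \<bar>f t\<bar> > s}"]
        by (simp add: order_less_le)
      have Tm: "{t \<in> I. ?T t \<le> ?e} \<in> sets lam"
      proof -
        note [measurable] = borel_measurable_spread
        have "{t \<in> space lam. ?T t \<le> ?e} \<in> sets lam" by measurable
        then show ?thesis by (simp only: space_lebesgue_on)
      qed
      have "measure lam {t \<in> I. \<bar>f (?T t)\<bar> > s} \<le> measure lam {t \<in> I. ?T t \<le> ?e}"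
        using sub by (intro level_mono_sets Tm) auto
      also have "\<dots> \<le> ?e" by (rule measure_spread_le[OF b r e])
      finally show ?thesis .
    qed
  qed
  have "integrable lam (\<lambda>t. \<bar>f (?T t)\<bar>)"
  proof (rule integral_le_of_levels(1)[where K=1])
    show "integrable lam (\<lambda>u. \<bar>f u\<bar>)" using decreasingD(2)[OF f] by simp
  qed (use zm lev in auto)
  then have zL: "(\<lambda>t. f (?T t)) \<in> L1" using zm integrable_abs_cancel by (auto simp: L1_def)
  note N = principal_ideal_least[OF decreasingD(3)[OF f]]
  show ?thesis
    by (rule symmetric_idealD(6)[OF N(1) N(2) zL])
      (use lev in \<open>auto intro!: rearr_mono decreasingD(1)[OF f] zm\<close>)
qed

text \<open>The affine bijection of the atom with the block scales the measure of initial intervals, so the level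
  sets of \<open>f\<close> in the block and those of \<open>f \<circ> spread\<close> in the atom occupy the same fractions, and the two
  averages agree; only one direction is recorded.\<close>

lemma spread_atom_integral:
  assumes f: "decreasing f" and b: "interval_partition b" and c: "interval_partition c"
    and z: "integrable lam (\<lambda>t. f (spread b c t))"
    and kj: "{b (Suc k)<..b k} \<subseteq> {c (Suc j)<..c j}"
  shows "(LINT u:{c (Suc j)<..c j}|lam. f u) / (c j - c (Suc j)) * (b k - b (Suc k))
    \<le> (LINT u:{b (Suc k)<..b k}|lam. f (spread b c u))"
proof -
  note P = interval_partitionD[OF b] and C = interval_partitionD[OF c]
  let ?B = "{b (Suc k)<..b k}" and ?C = "{c (Suc j)<..c j}"
  let ?\<beta> = "b k - b (Suc k)" and ?\<gamma> = "c j - c (Suc j)"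
  have \<beta>: "0 < ?\<beta>" and \<gamma>: "0 < ?\<gamma>" using P(3)[of k "Suc k"] C(3)[of j "Suc j"] by auto
  define g where "g u = indicator ?C u *\<^sub>R f u" for u
  define h where "h u = indicator ?B u *\<^sub>R f (spread b c u)" for u
  have gi: "integrable lam g" unfolding g_def
    by (intro integrable_mult_indicator interval_partition_atom[OF c] decreasingD(2)[OF f])
  have hi: "integrable lam h" unfolding h_def
    by (intro integrable_mult_indicator interval_partition_atom[OF b] z)
  have "(LINT u|lam. g u) \<le> ?\<gamma> / ?\<beta> * (LINT u|lam. h u)"
  proof (rule integral_le_of_levels(2)[OF _ hi])
    show "g \<in> borel_measurable lam" using gi by simp
    show "0 \<le> g u" if "u \<in> I" for u using decreasingD(4)[OF f, of u] that by (auto simp: g_def)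
    show "0 \<le> h u" if "u \<in> I" for u
      using decreasingD(4)[OF f, of "spread b c u"] spread_in_I[OF b c that] by (auto simp: h_def)
    show "0 \<le> ?\<gamma> / ?\<beta>" using \<beta> \<gamma> by simp
    fix s :: real assume s: "0 \<le> s"
    define e where "e = measure lam {u \<in> I. \<bar>f u\<bar> > s}"
    define m where "m = max (c (Suc j)) (min (c j) e)"
    have m: "c (Suc j) \<le> m" "m \<le> c j" using \<gamma> by (auto simp: m_def)
    have mI: "0 \<le> m" "m \<le> 1" using m C(4)[of "Suc j"] C(5)[of j] by auto
    have "{u \<in> I. g u > s} \<subseteq> {c (Suc j)<..m}"
    proof
      fix u assume "u \<in> {u \<in> I. g u > s}"
      then have u: "u \<in> I" "u \<in> ?C" "s < f u" using s by (cases "u \<in> ?C"; simp add: g_def)+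
      then have "u \<le> e" unfolding e_def by (intro decreasing_level(1)[OF f])
      then show "u \<in> {c (Suc j)<..m}" using u by (auto simp: m_def)
    qed
    then have "measure lam {u \<in> I. g u > s} \<le> measure lam {c (Suc j)<..m}"
      using m mI C(4)[of "Suc j"] by (intro level_mono_sets measure_lam_Ioc) auto
    also have "\<dots> = m - c (Suc j)" using m mI C(4)[of "Suc j"] by (intro measure_lam_Ioc) auto
    also have "\<dots> = ?\<gamma> / ?\<beta> * (?\<beta> * ((m - c (Suc j)) / ?\<gamma>))" using \<beta> \<gamma> by simp
    also have "?\<beta> * ((m - c (Suc j)) / ?\<gamma>) \<le> measure lam {u \<in> I. h u > s}"
    proof -
      let ?d = "b (Suc k) + ?\<beta> * ((m - c (Suc j)) / ?\<gamma>)"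
      have "?\<beta> * ((m - c (Suc j)) / ?\<gamma>) \<le> ?\<beta> * 1" using \<beta> \<gamma> m by (intro mult_left_mono) auto
      then have d: "?d \<le> b k" by simp
      have d0: "b (Suc k) \<le> ?d" using \<beta> \<gamma> m by simp
      have "{b (Suc k)<..<?d} \<subseteq> {u \<in> I. h u > s}"
      proof
        fix u assume u: "u \<in> {b (Suc k)<..<?d}"
        then have uk: "b (Suc k) < u" "u \<le> b k" using d by auto
        then have uj: "c (Suc j) < u" "u \<le> c j" using kj by auto
        have uI: "u \<in> I" using P(4)[of "Suc k"] P(5)[of k] uk by auto
        have lt: "spread b c u < m"
        proof -
          have 1: "u - b (Suc k) < ?\<beta> * ((m - c (Suc j)) / ?\<gamma>)" using u by auto
          have "(u - b (Suc k)) * (?\<gamma> / ?\<beta>) < ?\<beta> * ((m - c (Suc j)) / ?\<gamma>) * (?\<gamma> / ?\<beta>)"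
            using 1 \<beta> \<gamma> by (intro mult_strict_right_mono) auto
          also have "\<dots> = m - c (Suc j)" using \<beta> \<gamma> by simp
          finally show ?thesis using spread_atom(1)[OF b c uk uj] by linarith
        qed
        moreover have "c (Suc j) < spread b c u" using spread_atom(2)[OF b c uk uj] .
        ultimately have "spread b c u < e" by (auto simp: m_def)
        then have "s < f (spread b c u)"
          using decreasing_level(2)[OF f] spread_in_I[OF b c uI] unfolding e_def by auto
        then show "u \<in> {u \<in> I. h u > s}" using uI uk by (simp add: h_def)
      qed
      moreover have "{u \<in> I. h u > s} \<in> sets lam" using hi by (intro sets_superlevel) simp
      ultimately have "measure lam {b (Suc k)<..<?d} \<le> measure lam {u \<in> I. h u > s}"
        by (rule level_mono_sets)
      moreover have "measure lam {b (Suc k)<..<?d} = ?d - b (Suc k)"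
        using d d0 P(4)[of "Suc k"] P(5)[of k] by (intro measure_lam_Ioo) auto
      ultimately show ?thesis by simp
    qed
    finally show "measure lam {u \<in> I. g u > s} \<le> ?\<gamma> / ?\<beta> * measure lam {u \<in> I. h u > s}"
      using \<beta> \<gamma> by (simp add: mult_left_mono divide_right_mono)
  qed
  then show ?thesis using \<beta> \<gamma> unfolding set_lebesgue_integral_def g_def h_def
    by (simp add: field_simps)
qed

text \<open>The averages over the atoms of one block have a common lower bound, so the conditional expectation is
  at least this large almost everywhere on the whole block.\<close>

lemma cond_exp_spread_rearr:
  assumes f: "decreasing f" and b: "interval_partition b" and r: "strict_mono r" "r 0 = (0::nat)"
    and c: "c = (\<lambda>j. b (r j))" and t: "0 < t" "t < c j - c (Suc j)"
  shows "(LINT u:{c (Suc j)<..c j}|lam. f u) / (c j - c (Suc j))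
    \<le> rearr (real_cond_exp lam (partition_algebra b) (\<lambda>t. f (spread b c t))) t" (is "?v \<le> rearr ?E t")
proof (rule ccontr)
  assume nle: "\<not> ?thesis"
  interpret finite_measure_subalgebra lam "partition_algebra b" by (rule finite_measure_subalgebra_partition[OF b])
  have C: "interval_partition c" unfolding c by (rule interval_partition_subseq[OF b r])
  have "(\<lambda>t. f (spread b c t)) \<in> L1"
    using spread_in_principal_ideal[OF f b r] symmetric_idealD(2)[OF principal_ideal_least(1)[OF decreasingD(3)[OF f]]]
    unfolding c by blast
  then have z: "integrable lam (\<lambda>t. f (spread b c t))" by (simp add: L1_def)
  have Em: "?E \<in> borel_measurable lam" using real_cond_exp_int(1)[OF z] by simp
  have "AE u in lam. u \<in> {b (Suc k)<..b k} \<longrightarrow> u \<in> {c (Suc j)<..c j} \<longrightarrow> ?v \<le> ?E u" for k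
  proof (cases "{b (Suc k)<..b k} \<subseteq> {c (Suc j)<..c j}")
    case True
    show ?thesis
      using cond_exp_ge_on_atom[OF b z spread_atom_integral[OF f b C z True]] by eventually_elim simp
  next
    case False
    note P = interval_partitionD(2)[OF b]
    have "r (Suc j) \<le> k \<or> Suc k \<le> r j"
    proof (rule ccontr)
      assume "\<not> ?thesis"
      then have "b (r (Suc j)) \<le> b (Suc k)" "b k \<le> b (r j)" by (auto intro!: P)
      then show False using False unfolding c by auto
    qed
    then have "{b (Suc k)<..b k} \<inter> {c (Suc j)<..c j} = {}" unfolding c
      using P[of "r (Suc j)" k] P[of "Suc k" "r j"] by auto
    then show ?thesis by (intro AE_I2) blast
  qed
  then have "AE u in lam. \<forall>k. u \<in> {b (Suc k)<..b k} \<longrightarrow> u \<in> {c (Suc j)<..c j} \<longrightarrow> ?v \<le> ?E u"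
    by (subst AE_all_countable) blast
  then have ae: "AE u in lam. u \<in> {c (Suc j)<..c j} \<longrightarrow> u \<in> {u \<in> I. \<bar>?E u\<bar> > rearr ?E t}"
  proof eventually_elim
    case (elim u)
    show ?case
    proof
      assume u: "u \<in> {c (Suc j)<..c j}"
      then have uI: "u \<in> I" using interval_partition_atom(1)[OF C] by blast
      have "?v \<le> ?E u" using elim u atom_index(1,2)[OF b uI] by auto
      then show "u \<in> {u \<in> I. \<bar>?E u\<bar> > rearr ?E t}" using uI nle by auto
    qed
  qed
  have "c j - c (Suc j) \<le> measure lam {u \<in> I. \<bar>?E u\<bar> > rearr ?E t}"
    using finite_measure_mono_AE[OF ae sets_level[OF Em]] interval_partition_atom(3)[OF C] by simp
  moreover have "measure lam {u \<in> I. \<bar>?E u\<bar> > rearr ?E t} \<le> t"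
    using rearr_le_iff[OF Em t(1) rearr_nonneg[OF Em t(1)]] by simp
  ultimately show False using t by simp
qed

section \<open>Necessity\<close>

lemma tail_integral_tendsto:
  assumes f: "decreasing f" and b: "interval_partition b"
  shows "(\<lambda>n. LINT u:{0<..b n}|lam. f u) \<longlonglongrightarrow> 0"
proof -
  note P = interval_partitionD[OF b]
  have "(\<lambda>n. LINT u|lam. indicator {0<..b n} u *\<^sub>R f u) \<longlonglongrightarrow> (LINT u|lam. 0)"
  proof (rule integral_dominated_convergence)
    show "integrable lam (\<lambda>u. \<bar>f u\<bar>)" using decreasingD(2)[OF f] by simp
    show "(\<lambda>u. indicator {0<..b n} u *\<^sub>R f u) \<in> borel_measurable lam" for n
      using P(4,5)[of n] by (intro borel_measurable_scaleR borel_measurable_indicator decreasingD(1)[OF f] measure_lam_Ioc) auto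
    show "AE u in lam. (\<lambda>n. indicator {0<..b n} u *\<^sub>R f u) \<longlonglongrightarrow> 0"
    proof (rule AE_I2)
      fix u assume "u \<in> space lam"
      then obtain N where N: "\<And>n. n \<ge> N \<Longrightarrow> b n < u" using P(6)[of u] by (auto simp: space_lebesgue_on)
      show "(\<lambda>n. indicator {0<..b n} u *\<^sub>R f u) \<longlonglongrightarrow> 0"
        by (rule tendsto_eventually, rule eventually_mono[OF eventually_ge_at_top[of N]]) (auto dest: N)
    qed
  qed (auto simp: indicator_def)
  then show ?thesis by (simp add: set_lebesgue_integral_def)
qed

text \<open>The averaging hypothesis provides a constant for each single function of the ideal only.  One function
  that contradicts all \<open>Q\<close> at once is obtained from a sparse sequence of indices that violate the bound for
  larger and larger \<open>Q\<close>.\<close>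

lemma averages_imp_bound:
  assumes f: "decreasing f" and b: "interval_partition b"
    and av: "averages (partition_algebra b) (principal_ideal f)"
  shows "\<exists>Q>1. \<forall>n\<ge>1. (LINT u:{0<..b n}|lam. f u) / b n \<le> Q * f (b n / Q)"
proof (rule ccontr)
  assume neg: "\<not> ?thesis"
  note P = interval_partitionD[OF b]
  define J where "J c = (LINT u:{0<..c}|lam. f u)" for c
  note f0 = decreasingD(4)[OF f]
  have J0: "0 \<le> J (b n)" for n unfolding J_def set_lebesgue_integral_def
    using f0 by (intro integral_nonneg_AE) (auto simp: indicator_def space_lebesgue_on)
  have fi: "integrable lam (\<lambda>u. indicator {a<..c} u *\<^sub>R f u)" if "0 \<le> a" "a \<le> c" "c \<le> 1" for a c
    by (intro integrable_mult_indicator measure_lam_Ioc that decreasingD(2)[OF f])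
  have Jdiff: "(LINT u:{b m<..b n}|lam. f u) = J (b n) - J (b m)" if "n \<le> m" for m n
  proof -
    have *: "b m \<le> b n" "0 < b m" "0 < b n" "b n \<le> 1" using P that by auto
    have "J (b n) - J (b m) = (LINT u|lam. indicator {0<..b n} u *\<^sub>R f u - indicator {0<..b m} u *\<^sub>R f u)"
      unfolding J_def set_lebesgue_integral_def
      using * by (intro Bochner_Integration.integral_diff[symmetric] fi) auto
    also have "\<dots> = (LINT u:{b m<..b n}|lam. f u)" unfolding set_lebesgue_integral_def
      using * by (intro Bochner_Integration.integral_cong) (auto simp: indicator_def space_lebesgue_on)
    finally show ?thesis by simp
  qed
  have Jmono: "J (b m) \<le> J (b n)" if "n \<le> m" for m n
  proof -
    have "0 \<le> (LINT u:{b m<..b n}|lam. f u)" unfolding set_lebesgue_integral_def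
      using f0 by (intro integral_nonneg_AE) (auto simp: indicator_def space_lebesgue_on)
    then show ?thesis using Jdiff[OF that] by simp
  qed
  define bad where "bad Q n \<longleftrightarrow> Q * f (b n / Q) < J (b n) / b n" for Q n
  have ex_bad: "\<exists>n\<ge>1. bad Q n" if "1 < Q" for Q
    using neg that unfolding bad_def J_def by (meson not_le)
  have bad_mono: "bad Q n" if "bad Q' n" "1 < Q" "Q \<le> Q'" for Q Q' n
  proof -
    have "Q * f (b n / Q) \<le> Q' * f (b n / Q')"
    proof (intro mult_mono)
      show "f (b n / Q) \<le> f (b n / Q')"
        using that P(4)[of n] P(5)[of n] by (intro decreasingD(5)[OF f]) (auto simp: field_simps)
      show "0 \<le> f (b n / Q)" using that P(4)[of n] P(5)[of n] by (intro f0) (auto simp: field_simps)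
    qed (use that in auto)
    then show ?thesis using that(1) unfolding bad_def by simp
  qed
  have "\<exists>t0\<in>I. 0 < f t0"
  proof (rule ccontr)
    assume c: "\<not> ?thesis"
    obtain n where n: "bad 2 n" using ex_bad[of 2] by auto
    have "f u = 0" if "u \<in> I" for u using c that f0[of u] by (auto simp: order_less_le)
    then have "J (b n) = 0" unfolding J_def set_lebesgue_integral_def
      by (intro integral_eq_zero_AE AE_I2) (auto simp: space_lebesgue_on)
    moreover have "0 \<le> f (b n / 2)" using P(4)[of n] P(5)[of n] by (intro f0) auto
    ultimately show False using n by (simp add: bad_def)
  qed
  then obtain t0 where t0: "t0 \<in> I" "0 < f t0" by blast
  \<comment> \<open>A single index is not bad for large constants, so bad indices occur arbitrarily late.\<close>
  have fix_n: "\<exists>R>1. \<not> bad R n" for n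
  proof -
    define R where "R = 1 + 1 / t0 + J (b n) / b n / f t0"
    have R: "1 / t0 \<le> R" "J (b n) / b n / f t0 \<le> R" "1 < R"
      using t0 J0[of n] P(4)[of n] by (auto simp: R_def add_pos_nonneg add_increasing)
    have "b n / R \<le> 1 / R" using P(5)[of n] R by (simp add: divide_right_mono)
    also have "\<dots> \<le> t0" using R t0 by (simp add: field_simps)
    finally have "f t0 \<le> f (b n / R)" using P(4)[of n] R t0 by (intro decreasingD(5)[OF f]) auto
    then have "R * f t0 \<le> R * f (b n / R)" using R by simp
    moreover have "J (b n) / b n \<le> R * f t0" using R(2) pos_divide_le_eq[OF t0(2)] by blast
    ultimately have "\<not> bad R n" unfolding bad_def by linarith
    then show ?thesis using R(3) by blast
  qed
  then obtain R where R: "\<And>n. 1 < R n" "\<And>n. \<not> bad (R n) n" by metis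
  have late_bad: "\<exists>n\<ge>N. bad Q n" if Q: "1 < Q" for Q N
  proof -
    define Q' where "Q' = Q + (\<Sum>n<N. R n)"
    have R0: "0 \<le> R n" for n using R(1)[of n] by simp
    have s0: "0 \<le> (\<Sum>n<N. R n)" by (intro sum_nonneg R0)
    have Q': "1 < Q'" "Q \<le> Q'" using Q s0 by (auto simp: Q'_def)
    obtain n where n: "bad Q' n" using ex_bad[OF Q'(1)] by blast
    have "\<not> n < N"
    proof
      assume "n < N"
      then have "R n \<le> (\<Sum>n<N. R n)" by (intro member_le_sum) (auto intro: R0)
      then have "R n \<le> Q'" using Q by (simp add: Q'_def)
      then show False using bad_mono[OF n R(1)] R(2) by blast
    qed
    then show ?thesis using bad_mono[OF n Q Q'(2)] by (intro exI[of _ n]) auto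
  qed
  \<comment> \<open>The block from \<open>b m\<close> to \<open>b n\<close> keeps at least half of the length and of the integral over \<open>{0<..b n}\<close>.\<close>
  define sep where "sep n m \<longleftrightarrow> n < m \<and> b m \<le> b n / 2 \<and> J (b m) \<le> J (b n) / 2" for n m
  have ex_sep: "\<exists>N. \<forall>m\<ge>N. sep n m" for n
  proof -
    obtain N1 where N1: "\<And>m. m \<ge> N1 \<Longrightarrow> b m < b n / 2" using P(6)[of "b n / 2"] P(4)[of n] by auto
    obtain N2 where N2: "\<And>m. m \<ge> N2 \<Longrightarrow> J (b m) \<le> J (b n) / 2"
    proof (cases "J (b n) = 0")
      case True
      then show ?thesis using that[of n] Jmono[of n] by simp
    next
      case False
      then have "0 < J (b n) / 2" using J0[of n] by simp
      then have "eventually (\<lambda>m. J (b m) < J (b n) / 2) sequentially"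
        using order_tendstoD(2)[OF tail_integral_tendsto[OF f b]] unfolding J_def by blast
      then obtain N where "\<And>m. m \<ge> N \<Longrightarrow> J (b m) < J (b n) / 2" by (auto simp: eventually_sequentially)
      then show ?thesis using that less_imp_le by metis
    qed
    have "sep n m" if "max (Suc n) (max N1 N2) \<le> m" for m
      using that N1[of m] N2[of m] unfolding sep_def by simp
    then show ?thesis by blast
  qed
  have "\<exists>r. \<forall>j. (if j = 0 then r j = 0 else bad (real j + 1) (r j)) \<and> sep (r j) (r (Suc j))"
  proof (rule dependent_nat_choice)
    fix n j :: nat
    obtain N where N: "\<And>m. m \<ge> N \<Longrightarrow> sep n m" using ex_sep by blast
    obtain m where "m \<ge> N" "bad (real (Suc j) + 1) m" using late_bad[of "real (Suc j) + 1" N] by auto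
    then show "\<exists>m. (if Suc j = 0 then m = 0 else bad (real (Suc j) + 1) m) \<and> sep n m" using N by auto
  qed simp
  then obtain r where r: "\<And>j. if j = 0 then r j = 0 else bad (real j + 1) (r j)"
      "\<And>j. sep (r j) (r (Suc j))" by blast
  have r0: "r 0 = 0" using r(1)[of 0] by simp
  have rm: "strict_mono r" using r(2) by (intro strict_mono_Suc_iff[THEN iffD2]) (auto simp: sep_def)
  define c where "c = (\<lambda>j. b (r j))"
  have C: "interval_partition c" unfolding c_def by (rule interval_partition_subseq[OF b rm r0])
  let ?E = "real_cond_exp lam (partition_algebra b) (\<lambda>t. f (spread b c t))"
  have "?E \<in> principal_ideal f"
    using av spread_in_principal_ideal[OF f b rm r0] unfolding averages_def c_def by blast
  then obtain q where q: "1 < q" "\<And>t. t \<in> I \<Longrightarrow> rearr ?E t \<le> q * f (t / q) + q"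
    unfolding principal_ideal_decreasing[OF f] by blast
  define Q where "Q = 4 * q + 2 * q / f t0"
  have "0 \<le> 2 * q / f t0" using q(1) t0(2) by simp
  then have Q: "1 < Q" "4 * q \<le> Q" using q(1) unfolding Q_def by linarith+
  \<comment> \<open>Where \<open>f \<ge> f t0\<close>, the additive \<open>q\<close> in the description of the ideal is at most \<open>(q / f t0) * f\<close>.\<close>
  obtain N1 where N1: "\<And>j. j \<ge> N1 \<Longrightarrow> c j < t0" using interval_partitionD(6)[OF C, of t0] t0 by auto
  obtain N2 :: nat where N2: "Q \<le> real N2" using real_arch_simple by blast
  define j where "j = Suc (max N1 N2)"
  have j: "c j < t0" "Q \<le> real j + 1" using N1[of j] N2 by (auto simp: j_def)
  have "bad (real j + 1) (r j)" using r(1)[of j] by (simp add: j_def)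
  then have bad: "bad Q (r j)" by (rule bad_mono) (use Q j in auto)
  have cj: "0 < c j" "c j \<le> 1" "c (Suc j) \<le> c j / 2" "0 < c (Suc j)"
    using interval_partitionD(4,5)[OF C] r(2)[of j] by (auto simp: sep_def c_def)
  have Jj: "J (c (Suc j)) \<le> J (c j) / 2" using r(2)[of j] by (auto simp: sep_def c_def)
  have Jc0: "0 \<le> J (c j)" using J0 by (simp add: c_def)
  have "J (c j) / 2 / c j \<le> (J (c j) - J (c (Suc j))) / (c j - c (Suc j))"
    using cj Jj Jc0 by (intro frac_le) auto
  also have "\<dots> = (LINT u:{c (Suc j)<..c j}|lam. f u) / (c j - c (Suc j))"
    using Jdiff[of "r j" "r (Suc j)"] r(2)[of j] by (simp add: c_def sep_def)
  \<comment> \<open>\<open>c j / 4\<close> is less than the length of the block, which is at least \<open>c j / 2\<close>\<close>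
  also have "\<dots> \<le> rearr ?E (c j / 4)"
    by (rule cond_exp_spread_rearr[OF f b rm r0 c_def]) (use cj in auto)
  also have "\<dots> \<le> q * f (c j / 4 / q) + q" using cj by (intro q) auto
  also have "\<dots> \<le> q * f (c j / 4 / q) + q / f t0 * f (c j / 4 / q)"
  proof -
    have "c j / 4 / q \<le> c j" using cj q by (simp add: field_simps)
    then have "f t0 \<le> f (c j / 4 / q)" using j(1) cj q t0 by (intro decreasingD(5)[OF f]) auto
    then have "q / f t0 * f t0 \<le> q / f t0 * f (c j / 4 / q)" using q t0 by (intro mult_left_mono) auto
    then show ?thesis using t0 by simp
  qed
  also have "\<dots> = (q + q / f t0) * f (c j / (4 * q))" by (simp add: algebra_simps)
  finally have half: "J (c j) / 2 / c j \<le> (q + q / f t0) * f (c j / (4 * q))" .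
  have "J (c j) / c j = 2 * (J (c j) / 2 / c j)" by simp
  also have "\<dots> \<le> 2 * ((q + q / f t0) * f (c j / (4 * q)))" using half by (rule mult_left_mono) simp
  also have "\<dots> = (2 * q + 2 * q / f t0) * f (c j / (4 * q))" by (simp add: algebra_simps)
  also have "\<dots> \<le> Q * f (c j / Q)"
  proof (intro mult_mono)
    show "f (c j / (4 * q)) \<le> f (c j / Q)"
      using Q q cj by (intro decreasingD(5)[OF f]) (auto simp: field_simps)
    show "0 \<le> f (c j / (4 * q))" using q cj by (intro f0) (auto simp: field_simps)
  qed (use Q q in \<open>auto simp: Q_def\<close>)
  finally show False using bad by (simp add: bad_def c_def)
qed

section \<open>The characterisation\<close>

lemma max_rearr_eq_integral:
  assumes f: "f \<in> L1" "is_rearrangement f f" and c: "0 < c" "c < 1"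
  shows "max_rearr f c = (LINT u:{0<..c}|lam. f u) / c"
proof -
  have "rearr f u = f u" if "0 < u" "u < 1" for u
    using is_rearrangement_unique[OF is_rearrangement_rearr f(2)] f(1) that by (auto simp: L1_def)
  then have "(LINT u:{0<..c}|lebesgue. rearr f u) = (LINT u:{0<..c}|lebesgue. f u)"
    unfolding set_lebesgue_integral_def using c
    by (intro Bochner_Integration.integral_cong) (auto simp: indicator_def)
  also have "\<dots> = (LINT u:{0<..c}|lam. f u)"
    unfolding set_lebesgue_integral_def using c
    by (subst integral_restrict_space) (auto intro!: Bochner_Integration.integral_cong simp: indicator_def)
  finally show ?thesis by (simp add: max_rearr_def)
qed

theorem theorem4p1:
  fixes f :: "real \<Rightarrow> real" and b :: "nat \<Rightarrow> real"
  assumes "f \<in> L1" and "is_rearrangement f f" and "interval_partition b"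
  shows "(averages (partition_algebra b) (principal_ideal f) \<longrightarrow>
            (\<exists>Q>1. \<forall>n\<ge>1. max_rearr f (b n) \<le> Q * f (inverse Q * b n))) \<and>
         (monotonic_partition b \<longrightarrow>
            (averages (partition_algebra b) (principal_ideal f) \<longleftrightarrow>
              (\<exists>Q>1. \<forall>n\<ge>1. max_rearr f (b n) \<le> Q * f (inverse Q * b n))))"
proof -
  note P = interval_partitionD[OF assms(3)]
  have f: "decreasing f" using assms(1,2) by (auto simp: decreasing_def is_rearrangement_def)
  have "max_rearr f (b n) = (LINT u:{0<..b n}|lam. f u) / b n" if "1 \<le> n" for n
    using that P(1) P(3)[of 0 n] P(4)[of n] by (intro max_rearr_eq_integral assms) auto
  then have eq: "(\<forall>n\<ge>1. max_rearr f (b n) \<le> Q * f (inverse Q * b n)) \<longleftrightarrow>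
      (\<forall>n\<ge>1. (LINT u:{0<..b n}|lam. f u) / b n \<le> Q * f (b n / Q))" for Q
    by (simp add: divide_inverse mult.commute)
  show ?thesis unfolding eq
    using averages_imp_bound[OF f assms(3)] averages_principal_ideal[OF f assms(3)] by blast
qed

end
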